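(* Let $W\in\mathbb{R}^{n\times n}$ satisfy the network assumption and $f_1,\dots,f_n$ the cost assumption with constants $0<\mu\le L$ (see context). Let $\mathsf{Q}:\mathbb{R}^d\to\mathbb{R}^d$ be a (possibly stochastic, possibly biased) compressor satisfying, for some $\delta\in[0,1)$, $\mathbb{E}[\|\mathsf{Q}(\mathbf{x})-\mathbf{x}\|^2]\le\delta\|\mathbf{x}\|^2$ for all $\mathbf{x}\in\mathbb{R}^d$, and suppose $\delta'\triangleq\frac{4\sqrt{\delta}}{1-\delta}<1$. Let $\{X^k\},\{\Psi^k\},\{Y^k\},\{\widehat Y^k\}$ be generated by the COLD iteration (see context) with $$\gamma\in\Big(0,\frac{1-\delta}{\mu+L}\Big),\qquad \tau\in\Big(0,\frac{1-\delta}{2\gamma(1-\lambda_n(W))}\Big),$$ and let $$e^k=\mathbb{E}\Big(\|X^k-X^\star\|_{\gamma^{-1}}^2+\|\Psi^k-\Psi^\star\|_{\Theta+(1-\sqrt{\delta'}/2)\gamma I}^2+\|\Psi^k-\Psi^{k-1}\|_{\Theta}^2+\frac{1+\delta-4\sqrt{\delta}}{2\gamma\sqrt{\delta\delta'}}\|\widehat Y^k-Y^{k-1}\|^2\Big).$$ Then $$e^{k+1}\le\sigma e^k,\qquad \sigma=\max\Big\{1-\frac{2\mu L\gamma}{\mu+L},\ 1-\gamma\tau\rho(1-\sqrt{\delta'})\Big\}<1,$$ for all $k\ge1$, where $\rho=1-\lambda_2(W)$.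
   Context: Network assumption: $\mathcal{G}=(\mathcal{V},\mathcal{E},W)$ is a connected undirected graph on $\mathcal{V}=\{1,\dots,n\}$, $[W]_{ij}=0$ whenever $i\ne j$ and $(i,j)\notin\mathcal{E}$, and (a) $W=W^{\mathsf T}$; (b) $\mathrm{null}(I-W)=\mathrm{span}(\mathbf{1}_n)$; (c) $-I\prec W\preceq I$. $\lambda_j(W)$ is the $j$-th largest eigenvalue of $W$. Cost assumption: each $f_i:\mathbb{R}^d\to\mathbb{R}$ is differentiable and, for all $\mathbf{x},\mathbf{y}\in\mathbb{R}^d$, $f_i(\mathbf{y})\ge f_i(\mathbf{x})+\langle\nabla f_i(\mathbf{x}),\mathbf{y}-\mathbf{x}\rangle+\frac{\mu}{2}\|\mathbf{x}-\mathbf{y}\|^2$ and $\|\nabla f_i(\mathbf{x})-\nabla f_i(\mathbf{y})\|\le L\|\mathbf{x}-\mathbf{y}\|$. For $X=[\mathbf{x}_1,\dots,\mathbf{x}_n]^{\mathsf T}\in\mathbb{R}^{n\times d}$: $\nabla F(X)=[\nabla f_1(\mathbf{x}_1),\dots,\nabla f_n(\mathbf{x}_n)]^{\mathsf T}$ and $\mathsf{Q}(X)=[\mathsf{Q}(\mathbf{x}_1),\dots,\mathsf{Q}(\mathbf{x}_n)]^{\mathsf T}$. COLD iteration: given $X^0\in\mathbb{R}^{n\times d}$, initialize $X^1=Y^0=X^0-\gamma\nabla F(X^0)$, $\widehat Y^1=\mathsf{Q}(Y^0)$, $\Psi^1=\Psi^0=0$, and for $k\ge1$ $$Y^k=X^k-\gamma\nabla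 F(X^k)-\gamma\Psi^k,\quad \widehat Y^{k+1}=\widehat Y^k+\mathsf{Q}(Y^k-\widehat Y^k),$$ $$\Psi^{k+1}=\Psi^k+\tau(I-W)\widehat Y^{k+1},\quad X^{k+1}=X^k-\gamma\nabla F(X^k)-\gamma\Psi^{k+1}.$$ $X^\star=\mathbf{1}(\mathbf{x}^\star)^{\mathsf T}$ where $\mathbf{x}^\star$ is the unique minimizer of $\sum_{i=1}^n f_i$ over $\mathbb{R}^d$, and $\Psi^\star=-\nabla F(X^\star)$. $\Theta=\tau^{-1}(I-W)^\dagger-\gamma I$, with $\dagger$ the Moore–Penrose pseudoinverse. For a symmetric matrix or scalar $M$, $\|A\|_M^2=\mathrm{tr}(A^{\mathsf T}MA)$; $\|A\|$ is the Frobenius norm. $\mathbb{E}$ is the expectation over the randomness of $\mathsf{Q}$. *)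

theory Defs
  imports "HOL-Probability.Probability"
begin

definition loewner_le :: "real^'n^'n \<Rightarrow> real^'n^'n \<Rightarrow> bool" where
  "loewner_le A B \<longleftrightarrow> transpose (B - A) = B - A \<and> (\<forall>x. 0 \<le> x \<bullet> ((B - A) *v x))"

definition loewner_less :: "real^'n^'n \<Rightarrow> real^'n^'n \<Rightarrow> bool" where
  "loewner_less A B \<longleftrightarrow> transpose (B - A) = B - A \<and> (\<forall>x. x \<noteq> 0 \<longrightarrow> 0 < x \<bullet> ((B - A) *v x))"

definition eigenspace :: "real^'n^'n \<Rightarrow> real \<Rightarrow> (real^'n) set" where
  "eigenspace A l = {v. A *v v = l *\<^sub>R v}"

definition eigenvalues :: "real^'n^'n \<Rightarrow> real set" where
  "eigenvalues A = {l. \<exists>v. v \<noteq> 0 \<and> v \<in> eigenspace A l}"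

(* The multiplicity used is the dimension of the eigenspace; for the symmetric matrices
   considered here it coincides with the algebraic one. *)
definition eigenvalue_mset :: "real^'n^'n \<Rightarrow> real multiset" where
  "eigenvalue_mset A = (\<Sum>l\<in>eigenvalues A. replicate_mset (dim (eigenspace A l)) l)"

(* Counting starts at j = 1. *)
definition nth_largest_eigenvalue :: "nat \<Rightarrow> real^'n^'n \<Rightarrow> real" where
  "nth_largest_eigenvalue j A = rev (sorted_list_of_multiset (eigenvalue_mset A)) ! (j - 1)"

(* The four Penrose equations. *)
definition is_pseudoinverse :: "real^'n^'m \<Rightarrow> real^'m^'n \<Rightarrow> bool" where
  "is_pseudoinverse A P \<longleftrightarrow>
     A ** P ** A = A \<and> P ** A ** P = P \<and>
     transpose (A ** P) = A ** P \<and> transpose (P ** A) = P ** A"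

definition pseudoinverse :: "real^'n^'m \<Rightarrow> real^'m^'n" where
  "pseudoinverse A = (THE P. is_pseudoinverse A P)"

(* The squared weighted norm tr(A^T M A); a scalar weight c is written mat c. *)
definition wnorm2 :: "real^'n^'n \<Rightarrow> real^'d^'n \<Rightarrow> real" where
  "wnorm2 M A = trace (transpose A ** M ** A)"

definition rowwise :: "('n \<Rightarrow> real^'d \<Rightarrow> real^'d) \<Rightarrow> real^'d^'n \<Rightarrow> real^'d^'n" where
  "rowwise h X = (\<chi> i. h i (X $ i))"

(* The node set is the finite type 'n, so n = CARD('n). Self-loops in E are irrelevant. *)
definition network_assumption :: "'n rel \<Rightarrow> real^'n^'n \<Rightarrow> bool" where
  "network_assumption E W \<longleftrightarrow>
     sym E \<and> (\<forall>i j. (i, j) \<in> E\<^sup>*) \<and>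
     (\<forall>i j. i \<noteq> j \<and> (i, j) \<notin> E \<longrightarrow> W $ i $ j = 0) \<and>
     W = transpose W \<and>
     {v. (mat 1 - W) *v v = 0} = span {vec 1} \<and>
     loewner_less (- mat 1) W \<and> loewner_le W (mat 1)"

(* gf i is the gradient of f i. *)
definition cost_assumption ::
  "real \<Rightarrow> real \<Rightarrow> ('n \<Rightarrow> real^'d \<Rightarrow> real) \<Rightarrow> ('n \<Rightarrow> real^'d \<Rightarrow> real^'d) \<Rightarrow> bool" where
  "cost_assumption \<mu> L f gf \<longleftrightarrow>
     (\<forall>i x. GDERIV (f i) x :> gf i x) \<and>
     (\<forall>i x y. f i y \<ge> f i x + gf i x \<bullet> (y - x) + \<mu> / 2 * (norm (x - y))\<^sup>2) \<and>
     (\<forall>i x y. norm (gf i x - gf i y) \<le> L * norm (x - y))"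

(* A stochastic compressor is a measurable map Q s x of the input x and of a random seed s
   with law D; a deterministic compressor ignores s. The expectation is the Lebesgue integral
   of a nonnegative function, so the bound includes finiteness of the second moment. *)
definition compressor ::
  "real \<Rightarrow> 's measure \<Rightarrow> ('s \<Rightarrow> real^'d \<Rightarrow> real^'d) \<Rightarrow> bool" where
  "compressor \<delta> D Q \<longleftrightarrow>
     prob_space D \<and>
     (\<lambda>(s, x). Q s x) \<in> borel_measurable (D \<Otimes>\<^sub>M borel) \<and>
     (\<forall>x. (\<integral>\<^sup>+ s. ennreal ((norm (Q s x - x))\<^sup>2) \<partial>D) \<le> ennreal (\<delta> * (norm x)\<^sup>2))"

(* xi k i is the seed used by node i in its call of Q in round k. Each seed has law D, and
   the seeds of different rounds are independent. The joint law of the seeds of one round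
   is arbitrary: independent calls at the nodes and shared randomness are both covered. *)
definition fresh_seeds ::
  "'w measure \<Rightarrow> 's measure \<Rightarrow> (nat \<Rightarrow> 'n::finite \<Rightarrow> 'w \<Rightarrow> 's) \<Rightarrow> bool" where
  "fresh_seeds M D \<xi> \<longleftrightarrow>
     prob_space M \<and>
     (\<forall>k i. \<xi> k i \<in> measurable M D \<and> distr M D (\<xi> k i) = D) \<and>
     prob_space.indep_vars M (\<lambda>k. \<Pi>\<^sub>M i\<in>UNIV. D) (\<lambda>k \<omega> i. \<xi> k i \<omega>) UNIV"

(* C k is the realized row-wise compression of round k. The value Yh 0 is not used. *)
definition cold_iteration ::
  "real \<Rightarrow> real \<Rightarrow> real^'n^'n \<Rightarrow> ('n \<Rightarrow> real^'d \<Rightarrow> real^'d) \<Rightarrow>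
   (nat \<Rightarrow> real^'d^'n \<Rightarrow> real^'d^'n) \<Rightarrow> real^'d^'n \<Rightarrow>
   (nat \<Rightarrow> real^'d^'n) \<Rightarrow> (nat \<Rightarrow> real^'d^'n) \<Rightarrow>
   (nat \<Rightarrow> real^'d^'n) \<Rightarrow> (nat \<Rightarrow> real^'d^'n) \<Rightarrow> bool" where
  "cold_iteration \<gamma> \<tau> W gf C X0 X Y Yh \<Psi> \<longleftrightarrow>
     X 0 = X0 \<and>
     Y 0 = X 0 - \<gamma> *\<^sub>R rowwise gf (X 0) \<and>
     X 1 = Y 0 \<and>
     Yh 1 = C 0 (Y 0) \<and>
     \<Psi> 0 = 0 \<and> \<Psi> 1 = 0 \<and>
     (\<forall>k\<ge>1.
        Y k = X k - \<gamma> *\<^sub>R rowwise gf (X k) - \<gamma> *\<^sub>R \<Psi> k \<and>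
        Yh (k + 1) = Yh k + C k (Y k - Yh k) \<and>
        \<Psi> (k + 1) = \<Psi> k + \<tau> *\<^sub>R ((mat 1 - W) ** Yh (k + 1)) \<and>
        X (k + 1) = X k - \<gamma> *\<^sub>R rowwise gf (X k) - \<gamma> *\<^sub>R \<Psi> (k + 1))"

end

theory Submission
  imports Defs
begin

text \<open>
  COLD is an inexact primal-dual method. Write \<open>B = I - W\<close>, \<open>x = X^k - Xstar\<close>,
  \<open>\<psi> = \<Psi>^k - \<Psi>star\<close>, \<open>d = \<Psi>^k - \<Psi>^(k-1)\<close>, \<open>g\<close> for the gradient difference at \<open>X^k\<close> and
  \<open>Xstar\<close>, \<open>E = Yh^k - Y^(k-1)\<close> for the compression error, and mark quantities of the next round by a
  prime. All dual variables, and \<open>\<Psi>star\<close> as well because the gradients at the minimizer sum to zero,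
  lie in the range of \<open>B\<close>. There the pseudoinverse inverts \<open>B\<close>, so the dual update reads
  \<open>\<Theta> d' = x' + E'\<close> up to consensus vectors, which are orthogonal to everything dual. Expanding
  \<open>|x - \<gamma> g|\<^sup>2 = |x' + \<gamma> \<psi>'|\<^sup>2\<close> then gives the identity

  \<open>|x'|\<^sup>2/\<gamma> + |\<psi>'|\<^sup>2_(\<Theta>+\<gamma>) + |d'|\<^sup>2_\<Theta> = |x - \<gamma> g|\<^sup>2/\<gamma> + |\<psi>|\<^sup>2_\<Theta> + 2 (\<psi>', E')\<close>.

  The rate \<open>\<sigma>\<close> asks for only the part \<open>(1 - sqrt \<delta>') \<gamma>\<close> of the weight \<open>\<gamma>\<close> in front of \<open>|\<psi>'|\<^sup>2\<close>. Half of the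
  slack \<open>sqrt \<delta>' * \<gamma>\<close> absorbs the last term by Young's inequality (\<open>energy_step\<close>, \<open>lyapunov_step\<close>); what remains is the right-hand side without the inner product plus
  \<open>\<kappa> |E'|\<^sup>2\<close>. The expectation of \<open>|E'|\<^sup>2\<close> is at most \<open>\<delta>\<close> times that of \<open>|Y^k - Yh^k|\<^sup>2\<close>, since the
  seeds of round \<open>k\<close> are independent of the input of the compressor (\<open>fresh_compression\<close>). Finally
  \<open>Y^k - Yh^k = - \<gamma> (\<psi> + g + d) - E\<close>, and a weighted triangle inequality distributes this over the four
  quantities that the previous round controls (\<open>lyapunov_dissipation\<close>):

  \<^item> \<open>g\<close> is paid for by cocoercivity of the gradient, which leaves a negative multiple of \<open>|g|\<^sup>2\<close>
    (\<open>gradient_step_contraction\<close>);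

  \<^item> \<open>d\<close> by \<open>\<Theta> \<ge> (1+\<delta>)/(1-\<delta>) \<gamma>\<close> on the range of \<open>B\<close>, where the bound on \<open>\<tau>\<close> and the least eigenvalue
    of \<open>W\<close> enter (\<open>Theta_bounds\<close>);

  \<^item> \<open>\<psi>\<close> by the other half of the slack and by \<open>\<tau> \<rho> (\<Theta> + \<gamma>) \<le> I\<close>, where the spectral gap enters;

  \<^item> \<open>E\<close> by its own coefficient, because \<open>\<sigma> \<ge> 1 - (1-\<delta>)/2 (1 - sqrt \<delta>')\<close> (\<open>noise_weights\<close>).

  The eigenvalues of \<open>W\<close> are positions in a sorted list of eigenvalues with multiplicity. An orthonormal
  eigenbasis shows that this list has full length and turns the two positions into bounds on \<open>B\<close>
  (\<open>laplacian_spectral_bounds\<close>).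
\<close>

section \<open>Spectral theory of symmetric matrices\<close>

text \<open>The spectral theorem, by splitting off a maximizer \<open>v\<close> of the quadratic form on the unit sphere of the
  subspace. With \<open>m\<close> the maximum, the form \<open>m |w|\<^sup>2 - (w, f w)\<close> is nonnegative and vanishes at \<open>v\<close>, so its
  first variation at \<open>v\<close> vanishes, which says \<open>f v = m v\<close>. By symmetry the complement of \<open>v\<close> inside the
  subspace is invariant again. Working in an invariant subspace keeps the induction inside one type.\<close>

lemma self_adjoint_orthonormal_eigenbasis:
  fixes f :: "'a::euclidean_space \<Rightarrow> 'a"
  assumes lin: "linear f" and sym: "\<And>x y. f x \<bullet> y = x \<bullet> f y"
    and S: "subspace S" "f ` S \<subseteq> S"
  shows "\<exists>T. finite T \<and> pairwise orthogonal T \<and> (\<forall>v\<in>T. norm v = 1) \<and> span T = S \<and>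
              (\<forall>v\<in>T. f v = (v \<bullet> f v) *\<^sub>R v)"
  using S
proof (induction "dim S" arbitrary: S rule: less_induct)
  case less
  interpret linear f by (rule lin)
  show ?case
  proof (cases "S = {0}")
    case True
    then show ?thesis by (intro exI[of _ "{}"]) auto
  next
    case False
    have S: "subspace S" and inv: "\<And>w. w \<in> S \<Longrightarrow> f w \<in> S" using less.prems by auto
    then obtain a where a: "a \<in> S" "a \<noteq> 0" using False subspace_0 by fastforce
    have cont: "continuous_on (S \<inter> sphere 0 1) (\<lambda>w. w \<bullet> f w)"
      by (intro continuous_intros linear_continuous_on linear_conv_bounded_linear[THEN iffD1] lin)
    have comp: "compact (S \<inter> sphere 0 1)"
      using closed_subspace[OF S] by (simp add: closed_Int_compact)
    have "a /\<^sub>R norm a \<in> S \<inter> sphere 0 1" using a S by (auto simp: subspace_scale)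
    then have "S \<inter> sphere 0 1 \<noteq> {}" by blast
    from continuous_attains_sup[OF comp this cont]
    obtain v where v: "v \<in> S" "norm v = 1"
      and max: "\<And>w. w \<in> S \<inter> sphere 0 1 \<Longrightarrow> w \<bullet> f w \<le> v \<bullet> f v"
      by auto
    define m where "m = v \<bullet> f v"
    have form_nonneg: "0 \<le> m * (w \<bullet> w) - w \<bullet> f w" if "w \<in> S" for w
    proof (cases "w = 0")
      case True
      then show ?thesis by simp
    next
      case nz: False
      have "(w /\<^sub>R norm w) \<bullet> f (w /\<^sub>R norm w) \<le> m"
        unfolding m_def using that nz S by (intro max) (auto simp: subspace_scale)
      then have "(w \<bullet> f w) / (norm w)\<^sup>2 \<le> m"
        by (simp add: scale power2_eq_square divide_simps)
      then show ?thesis using nz by (simp add: field_simps dot_square_norm)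
    qed
    have crit: "w \<bullet> (m *\<^sub>R v - f v) = 0" if w: "w \<in> S" for w
    proof (rule ccontr)
      define b where "b = w \<bullet> (m *\<^sub>R v - f v)"
      define q where "q = m * (w \<bullet> w) - w \<bullet> f w"
      assume "w \<bullet> (m *\<^sub>R v - f v) \<noteq> 0"
      then have b: "b \<noteq> 0" by (simp add: b_def)
      have *: "0 \<le> 2 * t * b + t\<^sup>2 * q" for t
      proof -
        have "v + t *\<^sub>R w \<in> S" using v w S by (simp add: subspace_add subspace_scale)
        note form_nonneg[OF this]
        moreover have "v \<bullet> v = 1" "v \<bullet> f v = m" "v \<bullet> w = w \<bullet> v" "v \<bullet> f w = w \<bullet> f v"
          using v(2) sym[of v w] by (simp_all add: m_def norm_eq_1 inner_commute)
        ultimately show ?thesis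
          by (simp add: b_def q_def add scale inner_add_left inner_add_right inner_diff_right
              power2_eq_square) (simp add: algebra_simps)
      qed
      have q: "q \<ge> 0" using form_nonneg[OF w] by (simp add: q_def)
      \<comment> \<open>At \<open>t = - u\<close> the linear term beats the quadratic one, also when \<open>q = 0\<close>.\<close>
      define u where "u = b / (q + 1)"
      have bu: "b = u * (q + 1)" using q by (simp add: u_def)
      have "2 * (- u) * b + (- u)\<^sup>2 * q = u\<^sup>2 * (q - 2 * (q + 1))"
        unfolding bu by (simp add: power2_eq_square algebra_simps)
      also have "\<dots> < 0" using b q by (intro mult_pos_neg) (auto simp: u_def)
      finally show False using *[of "- u"] by simp
    qed
    have fv: "f v = m *\<^sub>R v"
      using crit[of "m *\<^sub>R v - f v"] v inv S by (simp add: subspace_diff subspace_scale)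
    define S' where "S' = {w \<in> S. v \<bullet> w = 0}"
    have S': "subspace S'"
      using S by (auto simp: S'_def subspace_def inner_add_right)
    have inv': "f ` S' \<subseteq> S'"
      using inv by (auto simp: S'_def sym[symmetric] fv)
    have "v \<notin> S'" using v by (auto simp: S'_def norm_eq_1)
    moreover have "S' \<subseteq> S" by (auto simp: S'_def)
    ultimately have "S' \<subset> S" using v(1) by blast
    then have "dim S' < dim S"
      using S S' by (metis dim_psubset span_eq_iff)
    from less.hyps[OF this S' inv'] obtain T where
      T: "finite T" "pairwise orthogonal T" "\<forall>v\<in>T. norm v = 1" "span T = S'"
         "\<forall>v\<in>T. f v = (v \<bullet> f v) *\<^sub>R v" by blast
    have TS': "T \<subseteq> S'" using T(4) span_superset by blast
    have "span (insert v T) = S"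
    proof
      show "span (insert v T) \<subseteq> S"
        using TS' v S by (intro span_minimal) (auto simp: S'_def)
      show "S \<subseteq> span (insert v T)"
      proof
        fix w assume w: "w \<in> S"
        have "w - (v \<bullet> w) *\<^sub>R v \<in> S'"
          using w v S by (auto simp: S'_def subspace_diff subspace_scale inner_diff_right norm_eq_1)
        then show "w \<in> span (insert v T)" unfolding T(4)[symmetric] by (auto simp: span_breakdown_eq)
      qed
    qed
    moreover have "pairwise orthogonal (insert v T)"
      using T(2) TS' by (auto simp: pairwise_insert S'_def orthogonal_def inner_commute)
    ultimately show ?thesis
      using T v fv by (intro exI[of _ "insert v T"]) (auto simp: m_def)
  qed
qed

lemma count_image_mset_set:
  assumes "finite T"
  shows "count (image_mset l (mset_set T)) c = card {v \<in> T. l v = c}"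
proof -
  have "count (image_mset l (mset_set T)) c = (\<Sum>v\<in>{v \<in> T. l v = c}. count (mset_set T) v)"
    unfolding count_image_mset' using assms by (intro sum.cong) auto
  also have "\<dots> = card {v \<in> T. l v = c}" using assms by simp
  finally show ?thesis .
qed

text \<open>Each eigenspace is spanned by the basis vectors that it contains: eigenvectors of different eigenvalues
  are orthogonal, so the other coordinates of an eigenvector are zero. Hence multiplicities count basis
  vectors.\<close>

lemma eigenvalue_mset_eigenbasis:
  fixes A :: "real^'n^'n"
  assumes sym: "\<And>x y. (A *v x) \<bullet> y = x \<bullet> (A *v y)"
    and T: "finite T" "pairwise orthogonal T" "\<forall>v\<in>T. norm v = 1" "span T = UNIV"
    and eig: "\<And>v. v \<in> T \<Longrightarrow> A *v v = l v *\<^sub>R v"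
  shows "eigenvalue_mset A = image_mset l (mset_set T)"
proof -
  have nz: "v \<noteq> 0" if "v \<in> T" for v using that T(3) by force
  have space: "eigenspace A c = span {v \<in> T. l v = c}" for c
  proof
    have "subspace (eigenspace A c)"
      by (auto simp: subspace_def eigenspace_def matrix_vector_right_distrib matrix_vector_mult_scaleR
          scaleR_right_distrib)
    then show "span {v \<in> T. l v = c} \<subseteq> eigenspace A c"
      by (intro span_minimal) (auto simp: eigenspace_def eig)
    show "eigenspace A c \<subseteq> span {v \<in> T. l v = c}"
    proof
      fix x assume x: "x \<in> eigenspace A c"
      have zero: "v \<bullet> x = 0" if v: "v \<in> T" "l v \<noteq> c" for v
      proof -
        have "c * (v \<bullet> x) = v \<bullet> (A *v x)" using x by (simp add: eigenspace_def)
        also have "\<dots> = l v * (v \<bullet> x)" by (simp add: sym[symmetric] eig v)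
        finally show ?thesis using v by simp
      qed
      have "x = (\<Sum>v\<in>T. (v \<bullet> x) *\<^sub>R v)"
        using orthonormal_basis_expand[of T x] T by (simp add: inner_commute)
      also have "\<dots> = (\<Sum>v\<in>{v \<in> T. l v = c}. (v \<bullet> x) *\<^sub>R v)"
        using T(1) zero by (intro sum.mono_neutral_right) auto
      also have "\<dots> \<in> span {v \<in> T. l v = c}"
        by (intro span_sum span_scale span_base)
      finally show "x \<in> span {v \<in> T. l v = c}" .
    qed
  qed
  have dim: "dim (eigenspace A c) = card {v \<in> T. l v = c}" for c
  proof -
    have "independent {v \<in> T. l v = c}"
      using T(2) nz by (intro pairwise_orthogonal_independent) (auto simp: pairwise_def)
    then show ?thesis by (simp add: space dim_eq_card_independent)
  qed
  have vals: "eigenvalues A = l ` T"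
  proof (intro equalityI subsetI)
    fix c assume "c \<in> eigenvalues A"
    then have "eigenspace A c \<noteq> {0}" by (auto simp: eigenvalues_def)
    then have "{v \<in> T. l v = c} \<noteq> {}" unfolding space by (metis span_empty)
    then show "c \<in> l ` T" by auto
  qed (use nz eig in \<open>auto simp: eigenvalues_def eigenspace_def\<close>)
  show ?thesis
  proof (rule multiset_eqI)
    fix c
    have "count (eigenvalue_mset A) c = (\<Sum>a\<in>l ` T. if a = c then card {v \<in> T. l v = a} else 0)"
      by (auto simp: eigenvalue_mset_def vals dim count_sum intro!: sum.cong)
    also have "\<dots> = card {v \<in> T. l v = c}"
      using T(1) by (auto simp: sum.delta card_eq_0_iff)
    also have "\<dots> = count (image_mset l (mset_set T)) c"
      by (rule count_image_mset_set[OF T(1), symmetric])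
    finally show "count (eigenvalue_mset A) c = count (image_mset l (mset_set T)) c" .
  qed
qed

lemma sorted_desc_nth:
  fixes xs :: "'a::linorder list"
  assumes "sorted (rev xs)" "i \<le> j" "j < length xs"
  shows "xs ! j \<le> xs ! i"
proof -
  have "rev xs ! (length xs - 1 - j) \<le> rev xs ! (length xs - 1 - i)"
    using assms by (intro sorted_nth_mono) auto
  then show ?thesis using assms by (simp add: rev_nth Suc_diff_Suc)
qed

lemma inner_transpose_mult:
  fixes A :: "real^'n^'m"
  shows "x \<bullet> (transpose A *v y) = (A *v x) \<bullet> y"
  by (metis dot_lmul_matrix transpose_matrix_vector transpose_transpose)

text \<open>The sorted eigenvalue list has \<open>CARD('n)\<close> entries, starts with 1 and contains 1 only once, because the
  kernel of \<open>I - W\<close> is a line. So its second entry is below 1, dominates every eigenvalue other than 1,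
  and its last entry is the least eigenvalue.\<close>

lemma eigenbasis_with_spectral_gap:
  fixes W :: "real^'n^'n"
  assumes card: "2 \<le> CARD('n)"
    and sym: "transpose W = W"
    and null: "{v. (mat 1 - W) *v v = 0} = span {vec 1}"
    and le1: "loewner_le W (mat 1)"
  defines "\<rho> \<equiv> 1 - nth_largest_eigenvalue 2 W"
    and "\<Lambda> \<equiv> 1 - nth_largest_eigenvalue CARD('n) W"
  obtains T \<beta> where "finite T" "pairwise orthogonal T" "\<forall>v\<in>T. norm v = 1" "span T = UNIV"
    "\<And>v. v \<in> T \<Longrightarrow> (mat 1 - W) *v v = \<beta> v *\<^sub>R v"
    "\<And>v. v \<in> T \<Longrightarrow> \<beta> v = 0 \<or> \<rho> \<le> \<beta> v \<and> \<beta> v \<le> \<Lambda>"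
    "0 < \<rho>" "\<rho> \<le> \<Lambda>"
proof -
  have adj: "(W *v x) \<bullet> y = x \<bullet> (W *v y)" for x y
    using inner_transpose_mult[of x W y] sym by simp
  obtain T where T: "finite T" "pairwise orthogonal T" "\<forall>v\<in>T. norm v = 1" "span T = UNIV"
    and Weig: "\<And>v. v \<in> T \<Longrightarrow> W *v v = (v \<bullet> (W *v v)) *\<^sub>R v"
    using self_adjoint_orthonormal_eigenbasis[of "(*v) W" UNIV] adj by (auto simp: matrix_vector_mul_linear)
  define l where "l v = v \<bullet> (W *v v)" for v
  have eig: "W *v v = l v *\<^sub>R v" if "v \<in> T" for v using Weig[OF that] by (simp add: l_def)
  have nz: "v \<noteq> 0" if "v \<in> T" for v using that T(3) by force
  have ind: "independent T" using T(2) nz pairwise_orthogonal_independent by blast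
  then have cardT: "card T = CARD('n)"
    using T(4) by (metis dim_UNIV DIM_cart DIM_real dim_span_eq_card_independent mult.right_neutral)
  have mset: "eigenvalue_mset W = image_mset l (mset_set T)"
    by (rule eigenvalue_mset_eigenbasis) (use T eig adj in auto)
  define xs where "xs = rev (sorted_list_of_multiset (eigenvalue_mset W))"
  have xs: "sorted (rev xs)" "mset xs = image_mset l (mset_set T)"
    by (simp_all add: xs_def mset sorted_sorted_list_of_multiset)
  have len: "length xs = CARD('n)"
    using arg_cong[OF xs(2), of size] T(1) by (simp add: cardT)
  have setxs: "set xs = l ` T"
    using arg_cong[OF xs(2), of set_mset] T(1) by simp
  have \<rho>: "\<rho> = 1 - xs ! 1" and \<Lambda>: "\<Lambda> = 1 - xs ! (CARD('n) - 1)"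
    by (simp_all add: \<rho>_def \<Lambda>_def nth_largest_eigenvalue_def xs_def)
  have lle1: "l v \<le> 1" if "v \<in> T" for v
  proof -
    have "0 \<le> v \<bullet> ((mat 1 - W) *v v)" using le1 by (simp add: loewner_le_def)
    also have "\<dots> = 1 - l v"
      using that T(3) by (simp add: matrix_vector_mult_diff_rdistrib eig inner_diff_right norm_eq_1)
    finally show ?thesis by simp
  qed
  have one_vec: "(mat 1 - W) *v vec 1 = 0" using null span_base[of "vec 1" "{vec 1 :: real^'n}"] by blast
  have eig1: "{v \<in> T. l v = 1} \<subseteq> span {vec 1}"
  proof safe
    fix v assume "v \<in> T" "l v = 1"
    then have "v \<in> {v. (mat 1 - W) *v v = 0}" by (simp add: matrix_vector_mult_diff_rdistrib eig)
    then show "v \<in> span {vec 1}" unfolding null .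
  qed
  have card1: "card {v \<in> T. l v = 1} \<le> 1"
  proof -
    have "independent {v \<in> T. l v = 1}" using ind by (rule independent_mono) auto
    then have "card {v \<in> T. l v = 1} \<le> card {vec 1 :: real^'n}"
      using independent_span_bound[OF _ _ eig1] by auto
    then show ?thesis by simp
  qed
  have ex1: "\<exists>v\<in>T. l v = 1"
  proof (rule ccontr)
    assume *: "\<not> (\<exists>v\<in>T. l v = 1)"
    have "v \<bullet> (vec 1 :: real^'n) = 0" if "v \<in> T" for v
    proof -
      have "v \<bullet> vec 1 = v \<bullet> (W *v vec 1)" using one_vec by (simp add: matrix_vector_mult_diff_rdistrib)
      also have "\<dots> = l v * (v \<bullet> vec 1)" by (simp add: adj[symmetric] eig that)
      finally show ?thesis using * that by auto
    qed
    then have "(\<Sum>v\<in>T. (vec 1 \<bullet> v) *\<^sub>R v) = 0" by (simp add: inner_commute)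
    moreover have "(\<Sum>v\<in>T. (vec 1 \<bullet> v) *\<^sub>R v) = vec 1"
      by (rule orthonormal_basis_expand) (use T in auto)
    ultimately have "(vec 1 :: real^'n) = 0" by simp
    then show False by (simp add: vec_eq_iff)
  qed
  have idx: "\<exists>i<length xs. xs ! i = l v" if "v \<in> T" for v
    using that setxs by (auto simp: in_set_conv_nth[symmetric])
  have ge: "xs ! (CARD('n) - 1) \<le> l v" if "v \<in> T" for v
  proof -
    obtain i where "i < length xs" "xs ! i = l v" using idx[OF \<open>v \<in> T\<close>] by blast
    then show ?thesis using sorted_desc_nth[OF xs(1), of i "CARD('n) - 1"] by (simp add: len)
  qed
  have xs0: "xs ! 0 = 1"
  proof (rule antisym)
    have "xs ! 0 \<in> l ` T" unfolding setxs[symmetric] using len card by (intro nth_mem) auto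
    then show "xs ! 0 \<le> 1" using lle1 by auto
    obtain v where "v \<in> T" "l v = 1" using ex1 by blast
    then obtain i where "i < length xs" "xs ! i = 1" using idx by fastforce
    then show "1 \<le> xs ! 0" using sorted_desc_nth[OF xs(1), of 0 i] by simp
  qed
  have count1: "card {i. i < length xs \<and> xs ! i = 1} \<le> 1"
  proof -
    have "card {i. i < length xs \<and> xs ! i = 1} = count (mset xs) 1"
      by (auto simp: count_mset count_list_eq_length_filter length_filter_conv_card intro!: arg_cong[where f = card])
    also have "\<dots> = card {v \<in> T. l v = 1}"
      unfolding xs(2) by (rule count_image_mset_set[OF T(1)])
    finally show ?thesis using card1 by simp
  qed
  have xs_lt: "xs ! 1 < 1"
  proof (rule ccontr)
    assume "\<not> xs ! 1 < 1"
    moreover have "xs ! 1 \<le> xs ! 0" using len card by (intro sorted_desc_nth[OF xs(1)]) auto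
    ultimately have "xs ! 1 = 1" using xs0 by simp
    then have "card {0, 1::nat} \<le> card {i. i < length xs \<and> xs ! i = 1}"
      using xs0 len card by (intro card_mono) auto
    then show False using count1 by simp
  qed
  have le2: "l v \<le> xs ! 1" if "v \<in> T" "l v \<noteq> 1" for v
  proof -
    obtain i where i: "i < length xs" "xs ! i = l v" using idx[OF \<open>v \<in> T\<close>] by blast
    then have "i \<noteq> 0" using xs0 that by metis
    then show ?thesis using sorted_desc_nth[OF xs(1), of 1 i] i by simp
  qed
  show ?thesis
  proof (rule that[of T "\<lambda>v. 1 - l v"])
    show "(mat 1 - W) *v v = (1 - l v) *\<^sub>R v" if "v \<in> T" for v
      using that by (simp add: matrix_vector_mult_diff_rdistrib eig scaleR_diff_left)
    show "1 - l v = 0 \<or> \<rho> \<le> 1 - l v \<and> 1 - l v \<le> \<Lambda>" if "v \<in> T" for v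
      using le2[OF that] ge[OF that] by (auto simp: \<rho> \<Lambda>)
    show "0 < \<rho>" using xs_lt by (simp add: \<rho>)
    show "\<rho> \<le> \<Lambda>" using sorted_desc_nth[OF xs(1), of 1 "CARD('n) - 1"] card by (simp add: \<rho> \<Lambda> len)
  qed (use T in auto)
qed

text \<open>The Penrose equations force \<open>A P = A Q\<close> and \<open>P A = Q A\<close>: \<open>A P = (A Q)(A P)\<close>, and transposing this product of
  symmetric matrices swaps the factors, which leaves \<open>A Q\<close>.\<close>

lemma is_pseudoinverse_unique:
  assumes P: "is_pseudoinverse A P" and Q: "is_pseudoinverse A Q"
  shows "P = Q"
proof -
  note defs = P[unfolded is_pseudoinverse_def] Q[unfolded is_pseudoinverse_def]
  have "A ** P = (A ** Q) ** (A ** P)" using defs by (metis matrix_mul_assoc)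
  also have "\<dots> = transpose ((A ** P) ** (A ** Q))" using defs by (simp add: matrix_transpose_mul)
  also have "\<dots> = A ** Q" using defs by (metis matrix_mul_assoc)
  finally have left: "A ** P = A ** Q" .
  have "P ** A = (P ** A) ** (Q ** A)" using defs by (metis matrix_mul_assoc)
  also have "\<dots> = transpose ((Q ** A) ** (P ** A))" using defs by (simp add: matrix_transpose_mul)
  also have "\<dots> = Q ** A" using defs by (metis matrix_mul_assoc)
  finally have right: "P ** A = Q ** A" .
  have "P = (P ** A) ** P" using defs by simp
  also have "\<dots> = Q ** (A ** P)" by (simp add: right matrix_mul_assoc)
  also have "\<dots> = Q" using defs by (simp add: left matrix_mul_assoc)
  finally show ?thesis .
qed

lemma eigenbasis_action:
  fixes A :: "real^'n^'n"
  assumes T: "finite T" "pairwise orthogonal T" "\<forall>v\<in>T. norm v = 1" "span T = UNIV"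
    and eig: "\<And>v. v \<in> T \<Longrightarrow> A *v v = \<beta> v *\<^sub>R v"
  shows "A *v x = (\<Sum>v\<in>T. (\<beta> v * (v \<bullet> x)) *\<^sub>R v)"
proof -
  have "x = (\<Sum>v\<in>T. (v \<bullet> x) *\<^sub>R v)"
    using orthonormal_basis_expand[of T x] T by (simp add: inner_commute)
  then have "A *v x = A *v (\<Sum>v\<in>T. (v \<bullet> x) *\<^sub>R v)" by simp
  also have "\<dots> = (\<Sum>v\<in>T. (\<beta> v * (v \<bullet> x)) *\<^sub>R v)"
    by (simp add: linear_sum[OF matrix_vector_mul_linear] matrix_vector_mult_scaleR eig mult.commute
        cong: sum.cong)
  finally show ?thesis .
qed

lemma orthonormal_inner_sum:
  assumes T: "finite T" "pairwise orthogonal T" "\<forall>v\<in>T. norm v = 1" and w: "w \<in> T"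
  shows "w \<bullet> (\<Sum>v\<in>T. c v *\<^sub>R v) = c w"
proof -
  have "w \<bullet> (\<Sum>v\<in>T. c v *\<^sub>R v) = (\<Sum>v\<in>T. if v = w then c v else 0)"
    unfolding inner_sum_right
    using T(2,3) w by (intro sum.cong) (auto simp: pairwise_def orthogonal_def norm_eq_1)
  then show ?thesis using T(1) w by simp
qed

lemma eigenbasis_inner:
  fixes A :: "real^'n^'n"
  assumes T: "finite T" "pairwise orthogonal T" "\<forall>v\<in>T. norm v = 1" "span T = UNIV"
    and eig: "\<And>v. v \<in> T \<Longrightarrow> A *v v = \<beta> v *\<^sub>R v"
  shows "x \<bullet> (A *v y) = (\<Sum>v\<in>T. \<beta> v * (v \<bullet> x) * (v \<bullet> y))"
  by (subst eigenbasis_action[OF assms])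
     (simp_all add: inner_sum_right inner_commute[of x] mult_ac)

text \<open>Existence through the functional calculus of an orthonormal eigenbasis: \<open>F h\<close> scales the eigenvector \<open>v\<close>
  by \<open>h v\<close>, \<open>F\<close> turns products of functions into matrix products, and the inverse of the eigenvalues,
  with the convention \<open>inverse 0 = 0\<close>, gives the pseudoinverse.\<close>

lemma symmetric_pseudoinverse:
  fixes A :: "real^'n^'n"
  assumes sym: "transpose A = A"
  shows "is_pseudoinverse A (pseudoinverse A)"
proof -
  have adj: "(A *v x) \<bullet> y = x \<bullet> (A *v y)" for x y
    using inner_transpose_mult[of x A y] sym by simp
  obtain T where T: "finite T" "pairwise orthogonal T" "\<forall>v\<in>T. norm v = 1" "span T = UNIV"
    and Aeig: "\<And>v. v \<in> T \<Longrightarrow> A *v v = (v \<bullet> (A *v v)) *\<^sub>R v"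
    using self_adjoint_orthonormal_eigenbasis[of "(*v) A" UNIV] adj by (auto simp: matrix_vector_mul_linear)
  define F where "F h = matrix (\<lambda>x. \<Sum>v\<in>T. (h v * (v \<bullet> x)) *\<^sub>R v)" for h
  have F: "F h *v x = (\<Sum>v\<in>T. (h v * (v \<bullet> x)) *\<^sub>R v)" for h x
  proof -
    have "linear (\<lambda>x. \<Sum>v\<in>T. (h v * (v \<bullet> x)) *\<^sub>R v)"
      by (rule linearI)
         (simp_all add: inner_add_right sum.distrib distrib_left scaleR_add_left scaleR_sum_right mult.left_commute)
    then show ?thesis unfolding F_def by (simp add: fun_cong[OF matrix_vector_mul(2)])
  qed
  have mult: "F h ** F k = F (\<lambda>v. h v * k v)" for h k
  proof (subst matrix_eq, rule allI)
    fix x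
    have "F h *v (F k *v x) = (\<Sum>v\<in>T. (h v * (v \<bullet> (F k *v x))) *\<^sub>R v)" by (rule F)
    also have "\<dots> = (\<Sum>v\<in>T. (h v * (k v * (v \<bullet> x))) *\<^sub>R v)"
      by (intro sum.cong refl) (simp add: F orthonormal_inner_sum[OF T(1-3)])
    finally show "(F h ** F k) *v x = F (\<lambda>v. h v * k v) *v x"
      by (simp add: matrix_vector_mul_assoc[symmetric] F mult.assoc)
  qed
  have symF: "transpose (F h) = F h" for h
  proof (subst matrix_eq, rule allI, rule vector_eq_ldot[THEN iffD1], rule allI)
    fix x z
    have "z \<bullet> (transpose (F h) *v x) = (F h *v z) \<bullet> x"
      by (rule inner_transpose_mult)
    also have "\<dots> = z \<bullet> (F h *v x)"
      unfolding F inner_sum_left inner_sum_right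
      by (intro sum.cong refl) (simp add: inner_commute[of z])
    finally show "z \<bullet> (transpose (F h) *v x) = z \<bullet> (F h *v x)" .
  qed
  define \<beta> where "\<beta> v = v \<bullet> (A *v v)" for v
  have A: "A = F \<beta>"
  proof (subst matrix_eq, rule allI)
    fix x
    have "A *v v = \<beta> v *\<^sub>R v" if "v \<in> T" for v
      unfolding \<beta>_def by (rule Aeig[OF that])
    from eigenbasis_action[OF T this] show "A *v x = F \<beta> *v x" unfolding F .
  qed
  have "is_pseudoinverse A (F (\<lambda>v. inverse (\<beta> v)))"
  proof -
    have *: "\<beta> v * inverse (\<beta> v) * \<beta> v = \<beta> v"
      and **: "inverse (\<beta> v) * \<beta> v * inverse (\<beta> v) = inverse (\<beta> v)" for v
      by (cases "\<beta> v = 0"; simp)+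
    show ?thesis unfolding is_pseudoinverse_def A mult symF * ** by simp
  qed
  then show ?thesis
    unfolding pseudoinverse_def by (metis (mono_tags, lifting) theI is_pseudoinverse_unique)
qed

section \<open>Weighted Frobenius norms\<close>

lemma wnorm2_eq_inner: "wnorm2 M A = A \<bullet> (M ** A)"
proof -
  have "wnorm2 M A = trace (transpose A ** (M ** A))"
    by (simp add: wnorm2_def matrix_mul_assoc)
  also have "\<dots> = (\<Sum>j\<in>UNIV. \<Sum>i\<in>UNIV. A $ i $ j * (M ** A) $ i $ j)"
    unfolding trace_def matrix_matrix_mult_def[of "transpose A"] by (simp add: transpose_def)
  also have "\<dots> = A \<bullet> (M ** A)"
    by (subst sum.swap) (simp add: inner_vec_def)
  finally show ?thesis .
qed

lemma inner_columns:
  fixes A C :: "real^'d^'n"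
  shows "A \<bullet> C = (\<Sum>j\<in>UNIV. column j A \<bullet> column j C)"
  by (simp add: inner_vec_def column_def) (rule sum.swap)

lemma column_mult: "column j (M ** A) = M *v column j A"
  by (simp add: vec_eq_iff column_def matrix_matrix_mult_def matrix_vector_mult_def)

lemma matrix_eq_columns: "(\<And>j. column j A = column j C) \<Longrightarrow> A = C"
  by (simp add: vec_eq_iff column_def)

lemma frobenius_adjoint:
  fixes M :: "real^'n^'n" and A C :: "real^'d^'n"
  assumes "transpose M = M"
  shows "(M ** A) \<bullet> C = A \<bullet> (M ** C)"
  unfolding inner_columns column_mult
  by (intro sum.cong refl) (metis assms inner_transpose_mult)

text \<open>In eigencoordinates \<open>|A u|\<^sup>2\<close> and \<open>(u, A u)\<close> are sums of \<open>\<beta>\<^sup>2\<close> and of \<open>\<beta>\<close> against the same weights, and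
  \<open>\<rho> \<beta> \<le> \<beta>\<^sup>2 \<le> \<Lambda> \<beta>\<close> also for \<open>\<beta> = 0\<close>.\<close>

lemma spectral_bounds_vector:
  fixes A :: "real^'n^'n"
  assumes T: "finite T" "pairwise orthogonal T" "\<forall>v\<in>T. norm v = 1" "span T = UNIV"
    and eig: "\<And>v. v \<in> T \<Longrightarrow> A *v v = \<beta> v *\<^sub>R v"
    and \<beta>: "\<And>v. v \<in> T \<Longrightarrow> \<beta> v = 0 \<or> \<rho> \<le> \<beta> v \<and> \<beta> v \<le> \<Lambda>" and "0 < \<rho>"
  shows "\<rho> * (u \<bullet> (A *v u)) \<le> (A *v u) \<bullet> (A *v u)"
    and "(A *v u) \<bullet> (A *v u) \<le> \<Lambda> * (u \<bullet> (A *v u))"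
proof -
  have coord: "v \<bullet> (A *v u) = \<beta> v * (v \<bullet> u)" if "v \<in> T" for v
    by (subst eigenbasis_action[OF T eig], assumption) (rule orthonormal_inner_sum[OF T(1-3) that])
  have eq1: "u \<bullet> (A *v u) = (\<Sum>v\<in>T. \<beta> v * (v \<bullet> u)\<^sup>2)"
    by (subst eigenbasis_inner[OF T eig], assumption) (simp add: power2_eq_square mult.assoc)
  have "(A *v u) \<bullet> (A *v u) = (\<Sum>v\<in>T. \<beta> v * (v \<bullet> (A *v u)) * (v \<bullet> u))"
    by (rule eigenbasis_inner[OF T eig])
  then have eq2: "(A *v u) \<bullet> (A *v u) = (\<Sum>v\<in>T. \<beta> v * \<beta> v * (v \<bullet> u)\<^sup>2)"
    by (simp add: coord power2_eq_square mult_ac cong: sum.cong)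
  have "\<rho> * \<beta> v \<le> \<beta> v * \<beta> v" "\<beta> v * \<beta> v \<le> \<Lambda> * \<beta> v" if "v \<in> T" for v
    using \<beta>[OF that] \<open>0 < \<rho>\<close> by (auto intro: mult_right_mono)
  then show "\<rho> * (u \<bullet> (A *v u)) \<le> (A *v u) \<bullet> (A *v u)"
    and "(A *v u) \<bullet> (A *v u) \<le> \<Lambda> * (u \<bullet> (A *v u))"
    unfolding eq1 eq2 sum_distrib_left mult.assoc[symmetric]
    by (auto intro!: sum_mono mult_right_mono[OF _ zero_le_power2])
qed

text \<open>The vector bounds, summed over the columns. They compare \<open>B\<close> with \<open>B\<^sup>2\<close> and thus bound the pseudoinverse
  on the range of \<open>B\<close> without mentioning it.\<close>

lemma laplacian_spectral_bounds:
  fixes W :: "real^'n^'n"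
  assumes card: "2 \<le> CARD('n)"
    and sym: "transpose W = W"
    and null: "{v. (mat 1 - W) *v v = 0} = span {vec 1}"
    and le1: "loewner_le W (mat 1)"
  defines "\<rho> \<equiv> 1 - nth_largest_eigenvalue 2 W"
    and "\<Lambda> \<equiv> 1 - nth_largest_eigenvalue CARD('n) W"
    and "B \<equiv> mat 1 - W"
  shows "0 < \<rho>" "\<rho> \<le> \<Lambda>"
    and "\<And>U :: real^'d^'n. \<rho> * (U \<bullet> (B ** U)) \<le> (norm (B ** U))\<^sup>2"
    and "\<And>U :: real^'d^'n. (norm (B ** U))\<^sup>2 \<le> \<Lambda> * (U \<bullet> (B ** U))"
proof -
  obtain T \<beta> where T: "finite T" "pairwise orthogonal T" "\<forall>v\<in>T. norm v = 1" "span T = UNIV"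
    and eig: "\<And>v. v \<in> T \<Longrightarrow> B *v v = \<beta> v *\<^sub>R v"
    and \<beta>: "\<And>v. v \<in> T \<Longrightarrow> \<beta> v = 0 \<or> \<rho> \<le> \<beta> v \<and> \<beta> v \<le> \<Lambda>"
    and \<rho>: "0 < \<rho>" "\<rho> \<le> \<Lambda>"
    using eigenbasis_with_spectral_gap[OF card sym null le1]
    unfolding \<rho>_def \<Lambda>_def B_def by blast
  show "0 < \<rho>" "\<rho> \<le> \<Lambda>" by fact+
  note bounds = spectral_bounds_vector[OF T eig \<beta> \<rho>(1)]
  show "\<rho> * (U \<bullet> (B ** U)) \<le> (norm (B ** U))\<^sup>2" for U :: "real^'d^'n"
    unfolding power2_norm_eq_inner inner_columns column_mult sum_distrib_left
    by (intro sum_mono bounds(1))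
  show "(norm (B ** U))\<^sup>2 \<le> \<Lambda> * (U \<bullet> (B ** U))" for U :: "real^'d^'n"
    unfolding power2_norm_eq_inner inner_columns column_mult sum_distrib_left
    by (intro sum_mono bounds(2))
qed

text \<open>The range of a symmetric matrix is the orthogonal complement of its kernel, with the pseudoinverse as
  the solution operator. The residual \<open>z\<close> lies in the kernel and is orthogonal to itself.\<close>

lemma symmetric_range:
  fixes A :: "real^'n^'n"
  assumes sym: "transpose A = A" and w: "\<And>z. A *v z = 0 \<Longrightarrow> z \<bullet> w = 0"
  shows "A *v (pseudoinverse A *v w) = w"
proof -
  define P where "P = pseudoinverse A"
  have P: "A ** P ** A = A" "transpose (A ** P) = A ** P"
    using symmetric_pseudoinverse[OF sym] by (auto simp: is_pseudoinverse_def P_def)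
  have AP: "A ** P = transpose P ** A" using P(2) by (simp add: matrix_transpose_mul sym)
  define z where "z = w - (A ** P) *v w"
  have "A ** (A ** P) = A"
    using P by (metis matrix_transpose_mul sym)
  then have Az: "A *v z = 0"
    by (simp add: z_def matrix_vector_mult_diff_distrib matrix_vector_mul_assoc)
  have "z \<bullet> ((A ** P) *v w) = ((A ** P) *v z) \<bullet> w"
    using inner_transpose_mult[of z "A ** P" w] by (simp only: P(2))
  also have "\<dots> = 0" unfolding AP using Az by (simp add: matrix_vector_mul_assoc[symmetric] del: transpose_matrix_vector)
  finally have "z \<bullet> z = 0" using w[OF Az] by (simp add: z_def inner_diff_right)
  then show ?thesis by (simp add: z_def P_def matrix_vector_mul_assoc)
qed

lemma mat_mult_scaleR: "mat c ** A = c *\<^sub>R A" for A :: "real^'d^'n"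
  by (simp add: vec_eq_iff matrix_matrix_mult_def mat_def if_distrib[of "\<lambda>x. x * _"] cong: if_cong)

lemma scaleR_matrix_mult: "(c *\<^sub>R A) ** C = c *\<^sub>R (A ** C)" for A :: "real^'m^'n"
  by (simp add: vec_eq_iff matrix_matrix_mult_def sum_distrib_left mult.assoc)

lemma matrix_mult_add_left: "(A + C) ** U = A ** U + C ** U" for A :: "real^'m^'n"
  by (simp add: vec_eq_iff matrix_matrix_mult_def sum.distrib distrib_right)

lemma matrix_mult_diff_left: "(A - C) ** U = A ** U - C ** U" for A :: "real^'m^'n"
  by (simp add: vec_eq_iff matrix_matrix_mult_def sum_subtractf left_diff_distrib)

lemma linear_matrix_mult: "linear ((**) A)" for A :: "real^'m^'n"
  by (rule linearI)
     (simp_all add: vec_eq_iff matrix_matrix_mult_def sum.distrib distrib_left sum_distrib_left mult.left_commute)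

lemma wnorm2_mat: "wnorm2 (mat c) A = c * (norm A)\<^sup>2"
  by (simp add: wnorm2_eq_inner mat_mult_scaleR power2_norm_eq_inner)

lemma wnorm2_add: "wnorm2 (M + N) A = wnorm2 M A + wnorm2 N A"
  by (simp add: wnorm2_eq_inner matrix_mult_add_left inner_add_right)

lemma norm_rows_square: "(norm A)\<^sup>2 = (\<Sum>i\<in>UNIV. (norm (A $ i))\<^sup>2)" for A :: "real^'d^'n"
  by (simp add: power2_norm_eq_inner inner_vec_def)

lemma rowwise_nth [simp]: "rowwise h A $ i = h i (A $ i)"
  by (simp add: rowwise_def)

lemma rowwise_lipschitz:
  assumes "\<And>i x y. norm (h i x - h i y) \<le> L * norm (x - y)" "0 \<le> L"
  shows "norm (rowwise h A - rowwise h C) \<le> L * norm (A - C)"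
proof (rule power2_le_imp_le)
  have "(norm (rowwise h A - rowwise h C))\<^sup>2 \<le> (\<Sum>i\<in>UNIV. (L * norm (A $ i - C $ i))\<^sup>2)"
    unfolding norm_rows_square using assms by (intro sum_mono) (auto intro: power_mono)
  then show "(norm (rowwise h A - rowwise h C))\<^sup>2 \<le> (L * norm (A - C))\<^sup>2"
    by (simp add: power_mult_distrib norm_rows_square[of "A - C"] sum_distrib_left)
qed (use assms in auto)

section \<open>Smooth strongly convex functions\<close>

text \<open>Along the segment from \<open>x\<close> to \<open>y\<close> the difference of the two sides is monotone, since its derivative is
  controlled by the Lipschitz bound and Cauchy--Schwarz.\<close>

lemma lipschitz_gradient_descent_lemma:
  fixes f :: "'a::real_inner \<Rightarrow> real"
  assumes D: "\<And>x. GDERIV f x :> g x" and lip: "\<And>x y. norm (g x - g y) \<le> L * norm (x - y)"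
  shows "f y \<le> f x + g x \<bullet> (y - x) + L / 2 * (norm (y - x))\<^sup>2"
proof -
  define h where "h = y - x"
  define \<phi> where "\<phi> t = f (x + t *\<^sub>R h) - t * (g x \<bullet> h) - L / 2 * t\<^sup>2 * (norm h)\<^sup>2" for t
  have "\<phi> 1 \<le> \<phi> 0"
  proof (rule DERIV_nonpos_imp_nonincreasing[of 0 1 \<phi>])
    fix t :: real assume t: "0 \<le> t" "t \<le> 1"
    have "((\<lambda>t. f (x + t *\<^sub>R h)) has_derivative (\<lambda>s. (s *\<^sub>R h) \<bullet> g (x + t *\<^sub>R h))) (at t)"
      by (rule has_derivative_compose[where f = "\<lambda>t. x + t *\<^sub>R h" and g = f])
         (use D in \<open>auto simp: gderiv_def intro!: derivative_eq_intros\<close>)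
    then have "((\<lambda>t. f (x + t *\<^sub>R h)) has_real_derivative (h \<bullet> g (x + t *\<^sub>R h))) (at t)"
      by (simp add: has_field_derivative_def mult.commute[of "h \<bullet> _"] inner_commute mult_commute_abs)
    then have "(\<phi> has_real_derivative (h \<bullet> g (x + t *\<^sub>R h) - g x \<bullet> h - L * t * (norm h)\<^sup>2)) (at t)"
      unfolding \<phi>_def by (auto intro!: derivative_eq_intros)
    moreover have "h \<bullet> g (x + t *\<^sub>R h) - g x \<bullet> h - L * t * (norm h)\<^sup>2 \<le> 0"
    proof -
      have "h \<bullet> g (x + t *\<^sub>R h) - g x \<bullet> h = h \<bullet> (g (x + t *\<^sub>R h) - g x)"
        by (simp add: inner_diff_right inner_commute)
      also have "\<dots> \<le> norm h * norm (g (x + t *\<^sub>R h) - g x)" by (rule norm_cauchy_schwarz)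
      also have "\<dots> \<le> norm h * (L * norm (t *\<^sub>R h))"
        using lip[of "x + t *\<^sub>R h" x] by (intro mult_left_mono) auto
      also have "\<dots> = L * t * (norm h)\<^sup>2" using t by (simp add: power2_eq_square)
      finally show ?thesis by simp
    qed
    ultimately show "\<exists>d. (\<phi> has_real_derivative d) (at t) \<and> d \<le> 0" by blast
  qed (rule zero_le_one)
  then show ?thesis by (simp add: \<phi>_def h_def)
qed

text \<open>Subtracting \<open>\<mu>/2 |.|\<^sup>2\<close> from \<open>f\<close> leaves a convex function with gradient difference \<open>D x y\<close> and smoothness
  \<open>L - \<mu>\<close>. Comparing its lower bound at \<open>x\<close> and its upper bound at \<open>y\<close> in the point \<open>y + t D x y\<close> gives
  \<open>gap\<close> for every step \<open>t\<close>. Adding the two orders of \<open>x\<close> and \<open>y\<close> and choosing \<open>t = 1/(L-\<mu>)\<close> gives the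
  claim; if \<open>L = \<mu>\<close>, large \<open>t\<close> force \<open>D x y = 0\<close>.\<close>

lemma strongly_convex_smooth_cocoercive:
  fixes f :: "'a::real_inner \<Rightarrow> real"
  assumes D: "\<And>x. GDERIV f x :> g x"
    and sc: "\<And>x y. f y \<ge> f x + g x \<bullet> (y - x) + \<mu> / 2 * (norm (x - y))\<^sup>2"
    and lip: "\<And>x y. norm (g x - g y) \<le> L * norm (x - y)"
    and \<mu>L: "0 < \<mu>" "\<mu> \<le> L"
  shows "\<mu> * L * (norm (x - y))\<^sup>2 + (norm (g x - g y))\<^sup>2 \<le> (\<mu> + L) * ((x - y) \<bullet> (g x - g y))"
proof -
  define D where "D x y = g x - g y - \<mu> *\<^sub>R (x - y)" for x y
  have gap: "t * (norm (D x y))\<^sup>2 - (L - \<mu>) / 2 * t\<^sup>2 * (norm (D x y))\<^sup>2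
      \<le> f y - f x - g x \<bullet> (y - x) - \<mu> / 2 * (norm (y - x))\<^sup>2" for x y t
  proof -
    define z where "z = y + t *\<^sub>R D x y"
    have "f x + g x \<bullet> (z - x) + \<mu> / 2 * (norm (x - z))\<^sup>2 \<le> f z" by (rule sc)
    also have "\<dots> \<le> f y + g y \<bullet> (z - y) + L / 2 * (norm (z - y))\<^sup>2"
      by (rule lipschitz_gradient_descent_lemma[OF assms(1) lip])
    finally have "f x + g x \<bullet> (z - x) + \<mu> / 2 * (norm (x - z))\<^sup>2
        \<le> f y + g y \<bullet> (z - y) + L / 2 * (norm (z - y))\<^sup>2" .
    moreover have "g x \<bullet> (z - x) + \<mu> / 2 * (norm (x - z))\<^sup>2 - g y \<bullet> (z - y) - L / 2 * (norm (z - y))\<^sup>2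
      = g x \<bullet> (y - x) + \<mu> / 2 * (norm (y - x))\<^sup>2
        + (t * (norm (D x y))\<^sup>2 - (L - \<mu>) / 2 * t\<^sup>2 * (norm (D x y))\<^sup>2)"
    proof -
      define d where "d = D x y"
      have gx: "g x = d + g y + \<mu> *\<^sub>R (x - y)" by (simp add: d_def D_def)
      have z: "z = y + t *\<^sub>R d" by (simp add: z_def d_def)
      show ?thesis
        unfolding z gx d_def[symmetric] power2_norm_eq_inner
        by (simp add: power2_eq_square inner_add_left inner_add_right inner_diff_left inner_diff_right inner_commute
            algebra_simps) (simp add: field_simps)
    qed
    ultimately show ?thesis by linarith
  qed
  define d where "d = D x y"
  have sym: "norm (D y x) = norm d"
  proof -
    have "D y x = - d" by (simp add: d_def D_def algebra_simps)
    then show ?thesis by simp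
  qed
  have main: "(2 * t - (L - \<mu>) * t\<^sup>2) * (norm d)\<^sup>2 \<le> d \<bullet> (x - y)" for t
  proof -
    have "f y - f x - g x \<bullet> (y - x) - \<mu> / 2 * (norm (y - x))\<^sup>2
        + (f x - f y - g y \<bullet> (x - y) - \<mu> / 2 * (norm (x - y))\<^sup>2) = d \<bullet> (x - y)"
      by (simp add: d_def D_def power2_norm_eq_inner inner_add_left inner_diff_left inner_diff_right
          inner_commute algebra_simps)
    note add_mono[OF gap[of t x y] gap[of t y x], unfolded sym d_def[symmetric], unfolded this]
    moreover have "(2 * t - (L - \<mu>) * t\<^sup>2) * (norm d)\<^sup>2
        = t * (norm d)\<^sup>2 - (L - \<mu>) / 2 * t\<^sup>2 * (norm d)\<^sup>2
          + (t * (norm d)\<^sup>2 - (L - \<mu>) / 2 * t\<^sup>2 * (norm d)\<^sup>2)"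
      by (simp add: field_simps)
    ultimately show ?thesis by simp
  qed
  have "(norm d)\<^sup>2 \<le> (L - \<mu>) * (d \<bullet> (x - y))"
  proof (cases "L = \<mu>")
    case False
    then have "L - \<mu> > 0" using \<mu>L by simp
    moreover from this have "1 / (L - \<mu>) * (norm d)\<^sup>2 \<le> d \<bullet> (x - y)"
      using main[of "1 / (L - \<mu>)"] by (simp add: power2_eq_square)
    ultimately show ?thesis by (simp add: field_simps)
  next
    case True
    have "(norm d)\<^sup>2 = 0"
    proof (rule ccontr)
      \<comment> \<open>The left side of \<open>main\<close> is now linear in \<open>t\<close>, and this \<open>t\<close> makes it too large.\<close>
      assume "(norm d)\<^sup>2 \<noteq> 0"
      then show False
        using main[of "(\<bar>d \<bullet> (x - y)\<bar> + 1) / (norm d)\<^sup>2"] True by (simp add: abs_if split: if_splits)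
    qed
    then show ?thesis using True by simp
  qed
  then show ?thesis
    by (simp add: d_def D_def power2_norm_eq_inner inner_diff_left inner_diff_right
        inner_commute algebra_simps)
qed

lemma gradient_sum_zero_at_minimum:
  fixes f :: "'i \<Rightarrow> 'a::real_inner \<Rightarrow> real"
  assumes D: "\<And>i. GDERIV (f i) x :> g i"
    and min: "is_arg_min (\<lambda>x. \<Sum>i\<in>I. f i x) (\<lambda>x. True) x"
  shows "(\<Sum>i\<in>I. g i) = 0"
proof -
  have "((\<lambda>x. \<Sum>i\<in>I. f i x) has_derivative (\<lambda>h. \<Sum>i\<in>I. h \<bullet> g i)) (at x)"
    using D by (intro has_derivative_sum) (simp add: gderiv_def)
  moreover have "(\<Sum>i\<in>I. f i x) \<le> (\<Sum>i\<in>I. f i y)" for y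
    using min by (simp add: is_arg_min_linorder)
  ultimately have "(\<lambda>h. \<Sum>i\<in>I. h \<bullet> g i) = (\<lambda>h. 0)"
    by (intro has_derivative_local_min always_eventually allI)
  then have "(\<Sum>i\<in>I. g i) \<bullet> (\<Sum>i\<in>I. g i) = 0" unfolding inner_sum_right by metis
  then show ?thesis by simp
qed

section \<open>Energy inequalities in an inner product space\<close>

lemma norm_add_square_le_weighted:
  fixes a b :: "'a::real_inner"
  assumes "0 < p" "0 < q" "p + q = 1"
  shows "(norm (a + b))\<^sup>2 \<le> (norm a)\<^sup>2 / p + (norm b)\<^sup>2 / q"
proof -
  have q: "q = 1 - p" using assms by simp
  have "0 \<le> (norm (q *\<^sub>R a - p *\<^sub>R b))\<^sup>2" by simp
  also have "\<dots> = q * (norm a)\<^sup>2 + p * (norm b)\<^sup>2 - p * q * (norm (a + b))\<^sup>2"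
    unfolding q power2_norm_eq_inner
    by (simp add: inner_add_left inner_add_right inner_diff_left inner_diff_right inner_commute[of b a]
        algebra_simps)
  finally have "p * q * (norm (a + b))\<^sup>2 \<le> q * (norm a)\<^sup>2 + p * (norm b)\<^sup>2" by simp
  then show ?thesis using assms(1,2) by (simp add: field_simps)
qed

lemma norm_add_square_le:
  fixes a b :: "'a::real_inner"
  shows "(norm (a + b))\<^sup>2 \<le> 2 * (norm a)\<^sup>2 + 2 * (norm b)\<^sup>2"
  using norm_add_square_le_weighted[of "1/2" "1/2" a b] by simp

lemma young_inner:
  fixes a b :: "'a::real_inner"
  assumes "0 < p"
  shows "2 * (a \<bullet> b) \<le> p * (norm a)\<^sup>2 + (norm b)\<^sup>2 / p"
proof -
  have "0 \<le> (norm (p *\<^sub>R a - b))\<^sup>2" by simp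
  also have "\<dots> = p * (p * (norm a)\<^sup>2 + (norm b)\<^sup>2 / p - 2 * (a \<bullet> b))"
    unfolding power2_norm_eq_inner using assms
    by (simp add: inner_diff_left inner_diff_right inner_commute[of b a] field_simps)
  finally show ?thesis using assms by (simp add: zero_le_mult_iff)
qed

text \<open>One primal-dual step, with \<open>z = x - \<gamma> g\<close> and with \<open>q\<psi>\<close>, \<open>q\<psi>'\<close>, \<open>qd\<close> for the \<open>\<Theta>\<close>-norms of \<open>\<psi>\<close>, \<open>\<psi>'\<close> and
  \<open>d'\<close>. The inner product of \<open>\<psi>'\<close> and \<open>x'\<close> occurs in the expansion of \<open>|z|\<^sup>2\<close> and in the expansion of
  the \<open>\<Theta>\<close>-norm of \<open>\<psi> = \<psi>' - d'\<close>, and cancels. For \<open>r = 0\<close> the weight \<open>2 / (\<gamma> * r)\<close> is 0 and Young's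
  inequality is unavailable, hence the premise that the error then vanishes.\<close>

lemma energy_step:
  fixes x' \<psi>' E :: "'a::real_inner"
  assumes \<gamma>: "0 < \<gamma>" and z: "z = x' + \<gamma> *\<^sub>R \<psi>'"
    and q: "q\<psi> = q\<psi>' - 2 * (\<psi>' \<bullet> (x' + E)) + qd"
    and r: "0 \<le> r" "r = 0 \<Longrightarrow> E = 0" and w: "\<kappa> - c = 2 / (\<gamma> * r)"
  shows "(norm x')\<^sup>2 / \<gamma> + (q\<psi>' + (1 - r / 2) * \<gamma> * (norm \<psi>')\<^sup>2) + qd + c * (norm E)\<^sup>2
     \<le> (norm z)\<^sup>2 / \<gamma> + q\<psi> + \<kappa> * (norm E)\<^sup>2"
proof -
  have "(norm z)\<^sup>2 / \<gamma> = (norm x')\<^sup>2 / \<gamma> + 2 * (\<psi>' \<bullet> x') + \<gamma> * (norm \<psi>')\<^sup>2"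
    unfolding z power2_norm_eq_inner using \<gamma>
    by (simp add: inner_add_left inner_add_right inner_commute[of x' \<psi>'] field_simps)
  moreover have "2 * (\<psi>' \<bullet> E) \<le> r / 2 * \<gamma> * (norm \<psi>')\<^sup>2 + (\<kappa> - c) * (norm E)\<^sup>2"
  proof (cases "r = 0")
    case True
    then show ?thesis using r by simp
  next
    case False
    then have "0 < r / 2 * \<gamma>" using r \<gamma> by simp
    from young_inner[OF this, of \<psi>' E] show ?thesis by (simp add: w mult.commute)
  qed
  ultimately show ?thesis unfolding q by (simp add: inner_add_right algebra_simps)
qed

text \<open>The scalar facts behind the choice of the coefficients. For \<open>\<delta> = 0\<close> both \<open>c\<close> and \<open>\<kappa>\<close> are 0 by the
  convention for division by 0, which is the right value for an exact compressor, so all claims hold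
  there too. The last claim needs \<open>2\<delta> \<le> \<sigma> (1 + \<delta> - 4 sqrt \<delta>)\<close>; in terms of \<open>b = 1 - \<delta>\<close> and
  \<open>r = sqrt \<delta>'\<close> the bracket is \<open>2 - b - r\<^sup>2 b\<close>, and the difference of the two sides, at the smallest
  admissible \<open>\<sigma>\<close>, factors as \<open>b (1 - r) (r + b (1 + r\<^sup>2) / 2)\<close>.\<close>

lemma noise_weights:
  fixes \<delta> \<delta>' \<gamma> \<sigma> :: real
  assumes \<delta>: "0 \<le> \<delta>" "\<delta> < 1" and \<delta>': "\<delta>' = 4 * sqrt \<delta> / (1 - \<delta>)" "\<delta>' < 1" and \<gamma>: "0 < \<gamma>"
    and \<sigma>: "1 - (1 - \<delta>) / 2 * (1 - sqrt \<delta>') \<le> \<sigma>"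
  defines "r \<equiv> sqrt \<delta>'"
    and "c \<equiv> (1 + \<delta> - 4 * sqrt \<delta>) / (2 * \<gamma> * sqrt (\<delta> * \<delta>'))"
    and "\<kappa> \<equiv> (1 + \<delta>) / (2 * \<gamma> * sqrt (\<delta> * \<delta>'))"
  shows "0 \<le> r" "r < 1" "r = 0 \<longleftrightarrow> \<delta> = 0" "r \<le> \<sigma>" "0 \<le> \<kappa>"
    and "\<kappa> - c = 2 / (\<gamma> * r)"
    and "\<kappa> * \<delta> * 2 / (1 - \<delta>) * \<gamma>\<^sup>2 = (1 + \<delta>) * r * \<gamma> / 4"
    and "\<kappa> * \<delta> * 2 / (1 + \<delta>) \<le> \<sigma> * c"
proof -
  have \<delta>'0: "0 \<le> \<delta>'" using \<delta> \<delta>' by simp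
  show r: "0 \<le> r" "r < 1" using \<delta>' \<delta>'0 by (simp_all add: r_def)
  show r0: "r = 0 \<longleftrightarrow> \<delta> = 0" using \<delta> by (simp add: r_def \<delta>'(1))
  have "(1 - \<delta>) / 2 * (1 - r) \<le> 1 * (1 - r)" using \<delta> r by (intro mult_right_mono) auto
  then show "r \<le> \<sigma>" using \<sigma> by (simp add: r_def)
  show "0 \<le> \<kappa>" using \<delta> \<delta>'0 \<gamma> by (simp add: \<kappa>_def)
  define s where "s = sqrt \<delta>"
  have s: "0 \<le> s" "\<delta> = s\<^sup>2" using \<delta> by (simp_all add: s_def)
  have r2: "r\<^sup>2 * (1 - \<delta>) = 4 * s" using \<delta> \<delta>'0 by (simp add: r_def s_def \<delta>'(1))
  have root: "sqrt (\<delta> * \<delta>') = s * r" by (simp add: real_sqrt_mult s_def r_def)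
  have nz: "r \<noteq> 0" if "s \<noteq> 0" using that r0 s by auto
  show "\<kappa> - c = 2 / (\<gamma> * r)"
  proof (cases "s = 0")
    case True
    then show ?thesis using r0 s by (simp add: \<kappa>_def c_def)
  next
    case False
    then show ?thesis using nz \<gamma> by (simp add: \<kappa>_def c_def root s_def[symmetric] divide_simps)
  qed
  show "\<kappa> * \<delta> * 2 / (1 - \<delta>) * \<gamma>\<^sup>2 = (1 + \<delta>) * r * \<gamma> / 4"
  proof (cases "s = 0")
    case True
    then show ?thesis using r0 s by simp
  next
    case False
    have "\<kappa> * \<delta> = (1 + \<delta>) * (s * s) / (2 * \<gamma> * (s * r))"
      unfolding \<kappa>_def root using s(2) by (simp add: power2_eq_square)
    then have "\<kappa> * \<delta> = (1 + \<delta>) * s / (2 * \<gamma> * r)"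
      using False by simp
    then have "\<kappa> * \<delta> * 2 / (1 - \<delta>) * \<gamma>\<^sup>2 = (1 + \<delta>) * s * \<gamma> / (r * (1 - \<delta>))"
      using \<gamma> by (simp add: power2_eq_square)
    also have "\<dots> = (1 + \<delta>) * (r\<^sup>2 * (1 - \<delta>)) * \<gamma> / (4 * r * (1 - \<delta>))"
      unfolding r2 by simp
    also have "\<dots> = (1 + \<delta>) * r * \<gamma> / 4"
    proof -
      have "1 - \<delta> \<noteq> 0" using \<delta> by simp
      then show ?thesis using nz[OF False] by (simp add: power2_eq_square del: right_diff_distrib_numeral)
    qed
    finally show ?thesis .
  qed
  have key: "2 * \<delta> \<le> \<sigma> * (1 + \<delta> - 4 * s)"
  proof -
    define b where "b = 1 - \<delta>"
    have b: "0 < b" "b \<le> 1" using \<delta> by (simp_all add: b_def)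
    have eq: "1 + \<delta> - 4 * s = 2 - b - r\<^sup>2 * b" using r2 by (simp add: b_def)
    have r2le: "r\<^sup>2 \<le> 1" using r by (simp add: power_le_one)
    have "2 - b - r\<^sup>2 * b \<ge> 0" using b r2le mult_mono[of "r\<^sup>2" 1 b 1] by simp
    then have "(1 - b / 2 * (1 - r)) * (2 - b - r\<^sup>2 * b) \<le> \<sigma> * (2 - b - r\<^sup>2 * b)"
      using \<sigma> by (intro mult_right_mono) (auto simp: b_def r_def)
    moreover have "(1 - b / 2 * (1 - r)) * (2 - b - r\<^sup>2 * b) - 2 * (1 - b)
        = b * (1 - r) * (r + b * (1 + r\<^sup>2) / 2)"
      by (simp add: field_simps power2_eq_square power3_eq_cube)
    moreover have "0 \<le> b * (1 - r) * (r + b * (1 + r\<^sup>2) / 2)"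
      using b r by (intro mult_nonneg_nonneg add_nonneg_nonneg divide_nonneg_nonneg) auto
    ultimately show ?thesis unfolding eq by (simp add: b_def)
  qed
  show "\<kappa> * \<delta> * 2 / (1 + \<delta>) \<le> \<sigma> * c"
  proof -
    have "\<kappa> * \<delta> * 2 / (1 + \<delta>) = 2 * \<delta> / (2 * \<gamma> * sqrt (\<delta> * \<delta>'))"
      using \<delta> by (simp add: \<kappa>_def)
    also have "\<dots> \<le> \<sigma> * (1 + \<delta> - 4 * s) / (2 * \<gamma> * sqrt (\<delta> * \<delta>'))"
      using key \<gamma> \<delta> \<delta>'0 by (intro divide_right_mono) auto
    finally show ?thesis by (simp add: c_def s_def)
  qed
qed

text \<open>The compressor input \<open>y\<close> against the old Lyapunov value. The weights \<open>(1+\<delta>)/2\<close> and \<open>(1-\<delta>)/2\<close> are used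
  twice: to separate the old error \<open>E\<close>, and to separate \<open>\<psi>\<close> from \<open>g + d\<close>. With them \<open>|\<psi>|\<^sup>2\<close> receives
  exactly the factor \<open>r/2 \<gamma>\<close>, which is the slack that is available, and \<open>|g|\<^sup>2\<close> and \<open>|d|\<^sup>2\<close> receive
  \<open>r (1+\<delta>)/(1-\<delta>) \<gamma>\<close>. The number \<open>\<theta>\<close> stands for \<open>\<gamma> \<tau> \<rho>\<close>.\<close>

lemma dissipation_step:
  fixes x z g \<psi> d E y :: "'a::real_inner"
  assumes \<delta>: "0 \<le> \<delta>" "\<delta> < 1" and \<gamma>: "0 < \<gamma>" and r: "0 \<le> r" "r \<le> \<sigma>" "r \<le> 1"
    and y: "y = - (\<gamma> *\<^sub>R (\<psi> + (g + d))) - E"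
    and z: "(norm z)\<^sup>2 \<le> \<sigma>1 * (norm x)\<^sup>2 - \<gamma>\<^sup>2 * ((1 + \<delta>) / (1 - \<delta>)) * (norm g)\<^sup>2"
    and \<sigma>1: "\<sigma>1 \<le> \<sigma>" and \<sigma>2: "1 - \<theta> * (1 - r) \<le> \<sigma>" and \<theta>: "0 \<le> \<theta>"
    and q\<psi>: "0 \<le> q\<psi>" "\<theta> * (q\<psi> + \<gamma> * (norm \<psi>)\<^sup>2) \<le> \<gamma> * (norm \<psi>)\<^sup>2"
    and qd: "(1 + \<delta>) / (1 - \<delta>) * \<gamma> * (norm d)\<^sup>2 \<le> qd"
    and \<kappa>: "0 \<le> \<kappa>" "\<kappa> * \<delta> * 2 / (1 - \<delta>) * \<gamma>\<^sup>2 = (1 + \<delta>) * r * \<gamma> / 4" "\<kappa> * \<delta> * 2 / (1 + \<delta>) \<le> \<sigma> * c"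
  shows "(norm z)\<^sup>2 / \<gamma> + q\<psi> + \<kappa> * (\<delta> * (norm y)\<^sup>2)
    \<le> \<sigma> * ((norm x)\<^sup>2 / \<gamma> + (q\<psi> + (1 - r / 2) * \<gamma> * (norm \<psi>)\<^sup>2) + qd + c * (norm E)\<^sup>2)"
proof -
  define a where "a = (1 + \<delta>) / (1 - \<delta>)"
  have a: "0 \<le> a" using \<delta> by (simp add: a_def)
  define v where "v = \<psi> + (g + d)"
  have half: "0 < (1 + \<delta>) / 2" "0 < (1 - \<delta>) / 2" "(1 + \<delta>) / 2 + (1 - \<delta>) / 2 = 1"
    using \<delta> by (auto simp: field_simps)
  have "norm y = norm (E + \<gamma> *\<^sub>R v)"
    unfolding y v_def by (metis add.commute minus_add_distrib norm_minus_cancel uminus_add_conv_diff minus_diff_eq diff_minus_eq_add)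
  then have ny: "(norm y)\<^sup>2 \<le> 2 / (1 + \<delta>) * (norm E)\<^sup>2 + 2 / (1 - \<delta>) * \<gamma>\<^sup>2 * (norm v)\<^sup>2"
    using norm_add_square_le_weighted[OF half, of E "\<gamma> *\<^sub>R v"] by (simp add: power_mult_distrib mult_ac)
  have nv: "(norm v)\<^sup>2 \<le> 2 / (1 + \<delta>) * (norm \<psi>)\<^sup>2 + 4 / (1 - \<delta>) * ((norm g)\<^sup>2 + (norm d)\<^sup>2)"
  proof -
    have "(norm v)\<^sup>2 \<le> 2 / (1 + \<delta>) * (norm \<psi>)\<^sup>2 + 2 / (1 - \<delta>) * (norm (g + d))\<^sup>2"
      unfolding v_def using norm_add_square_le_weighted[OF half, of \<psi> "g + d"] by (simp add: mult.commute)
    also have "(norm (g + d))\<^sup>2 \<le> 2 * ((norm g)\<^sup>2 + (norm d)\<^sup>2)"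
      using norm_add_square_le[of g d] by simp
    finally show ?thesis using \<delta> by (simp add: mult_left_mono divide_right_mono)
  qed
  have "\<kappa> * (\<delta> * (norm y)\<^sup>2)
      \<le> \<kappa> * \<delta> * (2 / (1 + \<delta>) * (norm E)\<^sup>2 + 2 / (1 - \<delta>) * \<gamma>\<^sup>2 * (norm v)\<^sup>2)"
    unfolding mult.assoc[symmetric] using ny \<kappa>(1) \<delta> by (intro mult_left_mono) auto
  also have "\<dots> = \<kappa> * \<delta> * 2 / (1 + \<delta>) * (norm E)\<^sup>2 + \<kappa> * \<delta> * 2 / (1 - \<delta>) * \<gamma>\<^sup>2 * (norm v)\<^sup>2"
    by (simp add: distrib_left mult.assoc)
  also have "\<dots> \<le> \<sigma> * c * (norm E)\<^sup>2 + (1 + \<delta>) * r * \<gamma> / 4 *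
      (2 / (1 + \<delta>) * (norm \<psi>)\<^sup>2 + 4 / (1 - \<delta>) * ((norm g)\<^sup>2 + (norm d)\<^sup>2))"
    unfolding \<kappa>(2) using nv \<kappa>(3) \<delta> r \<gamma> by (intro add_mono mult_right_mono mult_left_mono) auto
  also have "\<dots> = \<sigma> * c * (norm E)\<^sup>2 + r / 2 * \<gamma> * (norm \<psi>)\<^sup>2 + r * (a * \<gamma> * (norm g)\<^sup>2) + r * (a * \<gamma> * (norm d)\<^sup>2)"
  proof -
    have "p * r * \<gamma> / 4 * (2 / p * P + 4 / m * (G + D)) = r / 2 * \<gamma> * P + r * (p / m * \<gamma> * G) + r * (p / m * \<gamma> * D)"
      if "p \<noteq> 0" "m \<noteq> 0" for p m P G D :: real
      using that by (simp add: field_simps)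
    then show ?thesis using \<delta> by (simp add: a_def add.assoc)
  qed
  finally have noise: "\<kappa> * (\<delta> * (norm y)\<^sup>2) \<le> \<sigma> * c * (norm E)\<^sup>2 + r / 2 * \<gamma> * (norm \<psi>)\<^sup>2
      + r * (a * \<gamma> * (norm g)\<^sup>2) + r * (a * \<gamma> * (norm d)\<^sup>2)" .
  have "(norm z)\<^sup>2 \<le> \<sigma>1 * (norm x)\<^sup>2 - \<gamma> * (a * \<gamma> * (norm g)\<^sup>2)"
    using z \<gamma> by (simp add: a_def power2_eq_square mult_ac)
  also have "\<dots> \<le> \<sigma> * (norm x)\<^sup>2 - \<gamma> * (a * \<gamma> * (norm g)\<^sup>2)"
    using \<sigma>1 by (simp add: mult_right_mono)
  finally have "(norm z)\<^sup>2 / \<gamma> \<le> (\<sigma> * (norm x)\<^sup>2 - \<gamma> * (a * \<gamma> * (norm g)\<^sup>2)) / \<gamma>"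
    using \<gamma> by (intro divide_right_mono) auto
  then have zz: "(norm z)\<^sup>2 / \<gamma> \<le> \<sigma> * ((norm x)\<^sup>2 / \<gamma>) - a * \<gamma> * (norm g)\<^sup>2"
    using \<gamma> by (simp add: diff_divide_distrib)
  have gg: "r * (a * \<gamma> * (norm g)\<^sup>2) \<le> a * \<gamma> * (norm g)\<^sup>2"
    using r a \<gamma> by (intro mult_left_le_one_le) auto
  have dd: "r * (a * \<gamma> * (norm d)\<^sup>2) \<le> \<sigma> * qd"
  proof (rule mult_mono)
    show "a * \<gamma> * (norm d)\<^sup>2 \<le> qd" using qd by (simp add: a_def)
    show "0 \<le> a * \<gamma> * (norm d)\<^sup>2" using a \<gamma> by simp
  qed (use r in auto)
  have pp: "q\<psi> + r / 2 * \<gamma> * (norm \<psi>)\<^sup>2 \<le> \<sigma> * (q\<psi> + (1 - r / 2) * \<gamma> * (norm \<psi>)\<^sup>2)"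
  proof -
    define N where "N = q\<psi> + (1 - r / 2) * \<gamma> * (norm \<psi>)\<^sup>2"
    have N: "0 \<le> N" "N \<le> q\<psi> + \<gamma> * (norm \<psi>)\<^sup>2"
    proof -
      show "0 \<le> N"
        unfolding N_def using q\<psi>(1) r \<gamma> by (intro add_nonneg_nonneg mult_nonneg_nonneg) auto
      have "(1 - r / 2) * \<gamma> * (norm \<psi>)\<^sup>2 \<le> 1 * \<gamma> * (norm \<psi>)\<^sup>2"
        using r \<gamma> by (intro mult_right_mono) auto
      then show "N \<le> q\<psi> + \<gamma> * (norm \<psi>)\<^sup>2" by (simp add: N_def)
    qed
    have "(1 - \<theta> * (1 - r)) * N \<le> \<sigma> * N" using \<sigma>2 N by (intro mult_right_mono)
    moreover have "(1 - r) * (\<theta> * N) \<le> (1 - r) * (\<gamma> * (norm \<psi>)\<^sup>2)"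
      using q\<psi>(2) N \<theta> r by (intro mult_left_mono order_trans[OF _ q\<psi>(2)]) auto
    moreover have "q\<psi> + r / 2 * \<gamma> * (norm \<psi>)\<^sup>2 = N - (1 - r) * (\<gamma> * (norm \<psi>)\<^sup>2)"
      by (simp add: N_def field_simps)
    ultimately show ?thesis unfolding N_def[symmetric] by (simp add: algebra_simps)
  qed
  have "\<sigma> * ((norm x)\<^sup>2 / \<gamma> + (q\<psi> + (1 - r / 2) * \<gamma> * (norm \<psi>)\<^sup>2) + qd + c * (norm E)\<^sup>2)
    = \<sigma> * ((norm x)\<^sup>2 / \<gamma>) + \<sigma> * (q\<psi> + (1 - r / 2) * \<gamma> * (norm \<psi>)\<^sup>2) + \<sigma> * qd + \<sigma> * c * (norm E)\<^sup>2"
    by (simp add: distrib_left mult.assoc)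
  then show ?thesis using noise zz gg dd pp by linarith
qed

section \<open>Randomness: fresh seeds and square integrability\<close>

lemma borel_measurable_rowsI:
  fixes F :: "'w \<Rightarrow> real^'d^'n"
  assumes "\<And>i. (\<lambda>\<omega>. F \<omega> $ i) \<in> borel_measurable N"
  shows "F \<in> borel_measurable N"
proof (subst borel_measurable_euclidean_space, rule ballI)
  fix b :: "real^'d^'n" assume "b \<in> Basis"
  then obtain i u where "b = axis i u" by (auto simp: Basis_vec_def)
  then show "(\<lambda>\<omega>. F \<omega> \<bullet> b) \<in> borel_measurable N" using assms[of i] by (simp add: inner_axis)
qed

lemma borel_measurable_row:
  fixes F :: "'w \<Rightarrow> real^'d^'n"
  assumes "F \<in> borel_measurable N"
  shows "(\<lambda>\<omega>. F \<omega> $ i) \<in> borel_measurable N"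
  using assms
  by (rule measurable_compose) (intro borel_measurable_continuous_onI continuous_intros)

text \<open>The sigma algebra of the seeds of the rounds before \<open>k\<close>; being determined by the past becomes
  measurability, which composes.\<close>

definition seed_history ::
  "'w measure \<Rightarrow> 's measure \<Rightarrow> (nat \<Rightarrow> 'n \<Rightarrow> 'w \<Rightarrow> 's) \<Rightarrow> nat \<Rightarrow> 'w measure" where
  "seed_history M D \<xi> k = vimage_algebra (space M) (\<lambda>\<omega>. \<lambda>j\<in>{..<k}. \<lambda>i. \<xi> j i \<omega>)
     (\<Pi>\<^sub>M j\<in>{..<k}. \<Pi>\<^sub>M i\<in>UNIV. D)"

lemma space_seed_history [simp]: "space (seed_history M D \<xi> k) = space M"
  by (simp add: seed_history_def)

lemma history_map_measurable:
  assumes "fresh_seeds M D \<xi>"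
  shows "(\<lambda>\<omega>. \<lambda>j\<in>{..<k}. \<lambda>i. \<xi> j i \<omega>) \<in> measurable M (\<Pi>\<^sub>M j\<in>{..<k}. \<Pi>\<^sub>M i\<in>UNIV. D)"
proof -
  have [measurable]: "\<xi> j i \<in> measurable M D" for j i using assms by (auto simp: fresh_seeds_def)
  have "(\<lambda>\<omega> i. \<xi> j i \<omega>) \<in> measurable M (\<Pi>\<^sub>M i\<in>UNIV. D)" for j
    by (rule measurable_abs_UNIV) simp
  then show ?thesis by (rule measurable_restrict)
qed

lemma seed_history_sub:
  assumes "fresh_seeds M D \<xi>" "f \<in> measurable (seed_history M D \<xi> k) N"
  shows "f \<in> measurable M N"
proof (rule measurable_compose[OF _ assms(2)])
  show "(\<lambda>\<omega>. \<omega>) \<in> measurable M (seed_history M D \<xi> k)"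
    unfolding seed_history_def
    by (rule measurable_vimage_algebra2) (auto intro: history_map_measurable assms(1))
qed

lemma history_map_measurable_history:
  assumes "fresh_seeds M D \<xi>"
  shows "(\<lambda>\<omega>. \<lambda>j\<in>{..<k}. \<lambda>i. \<xi> j i \<omega>) \<in> measurable (seed_history M D \<xi> k) (\<Pi>\<^sub>M j\<in>{..<k}. \<Pi>\<^sub>M i\<in>UNIV. D)"
  unfolding seed_history_def
  by (rule measurable_vimage_algebra1) (use measurable_space[OF history_map_measurable[OF assms]] in auto)

lemma seed_history_mono:
  assumes "fresh_seeds M D \<xi>" "f \<in> measurable (seed_history M D \<xi> k) N" "k \<le> l"
  shows "f \<in> measurable (seed_history M D \<xi> l) N"
proof (rule measurable_compose[OF _ assms(2)])
  have "(\<lambda>\<omega>. restrict (\<lambda>j\<in>{..<l}. \<lambda>i. \<xi> j i \<omega>) {..<k})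
      \<in> measurable (seed_history M D \<xi> l) (\<Pi>\<^sub>M j\<in>{..<k}. \<Pi>\<^sub>M i\<in>UNIV. D)"
    by (rule measurable_compose[OF history_map_measurable_history[OF assms(1)] measurable_restrict_subset])
       (use assms(3) in auto)
  then have "(\<lambda>\<omega>. \<lambda>j\<in>{..<k}. \<lambda>i. \<xi> j i \<omega>)
      \<in> measurable (seed_history M D \<xi> l) (\<Pi>\<^sub>M j\<in>{..<k}. \<Pi>\<^sub>M i\<in>UNIV. D)"
    using assms(3) by (simp add: Int_absorb1)
  then show "(\<lambda>\<omega>. \<omega>) \<in> measurable (seed_history M D \<xi> l) (seed_history M D \<xi> k)"
    unfolding seed_history_def[of _ _ _ k]
    by (intro measurable_vimage_algebra2) auto
qed

lemma seed_measurable_history: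
  assumes "fresh_seeds M D \<xi>" "j < k"
  shows "\<xi> j i \<in> measurable (seed_history M D \<xi> k) D"
proof -
  have "(\<lambda>\<omega>. (\<lambda>j\<in>{..<k}. \<lambda>i. \<xi> j i \<omega>) j i) \<in> measurable (seed_history M D \<xi> k) D"
    using measurable_compose[OF measurable_compose[OF history_map_measurable_history[OF assms(1)]
          measurable_component_singleton[of j "{..<k}" "\<lambda>_. \<Pi>\<^sub>M i\<in>UNIV. D"]]
          measurable_component_singleton[of i UNIV "\<lambda>_. D"]] assms(2) by simp
  then show ?thesis using assms(2) by simp
qed

text \<open>Independence of the past from the seed of round \<open>k\<close>, in the form that Fubini's theorem consumes. It is
  checked on rectangles, where it is the independence of the sigma algebras generated by the seeds of the
  rounds before \<open>k\<close> and of round \<open>k\<close>.\<close>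

lemma joint_law_history_seed:
  fixes \<xi> :: "nat \<Rightarrow> 'n::finite \<Rightarrow> 'w \<Rightarrow> 's"
  assumes seeds: "fresh_seeds M D \<xi>" and Z: "Z \<in> measurable (seed_history M D \<xi> k) N"
  shows "distr M N Z \<Otimes>\<^sub>M D = distr M (N \<Otimes>\<^sub>M D) (\<lambda>\<omega>. (Z \<omega>, \<xi> k i \<omega>))"
proof -
  interpret prob_space M using seeds by (simp add: fresh_seeds_def)
  define H where "H = (\<lambda>\<omega>. \<lambda>j\<in>{..<k}. \<lambda>i. \<xi> j i \<omega>)"
  define P where "P = (\<Pi>\<^sub>M j\<in>{..<k}. \<Pi>\<^sub>M i\<in>(UNIV :: 'n set). D)"
  define H' where "H' = (\<lambda>\<omega>. \<lambda>j\<in>{k}. \<lambda>i. \<xi> j i \<omega>)"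
  define P' where "P' = (\<Pi>\<^sub>M j\<in>{k}. \<Pi>\<^sub>M i\<in>(UNIV :: 'n set). D)"
  have S [measurable]: "\<xi> k i \<in> measurable M D" and law: "distr M D (\<xi> k i) = D"
    using seeds by (auto simp: fresh_seeds_def)
  have ZM [measurable]: "Z \<in> measurable M N" by (rule seed_history_sub[OF seeds Z])
  interpret D: prob_space D using prob_space_distr[OF S] by (simp add: law)
  interpret ZN: prob_space "distr M N Z" by (rule prob_space_distr[OF ZM])
  have "indep_vars (\<lambda>k. \<Pi>\<^sub>M i\<in>UNIV. D) (\<lambda>k \<omega> i. \<xi> k i \<omega>) UNIV"
    using seeds by (simp add: fresh_seeds_def)
  from indep_var_restrict[OF this, of "{..<k}" "{k}"]
  have "indep_var P H P' H'" by (simp add: H_def P_def H'_def P'_def)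
  then have H'_rv: "H' \<in> measurable M P'"
    and ind: "indep_set (sigma_sets (space M) {H -` A \<inter> space M |A. A \<in> sets P})
      (sigma_sets (space M) {H' -` A \<inter> space M |A. A \<in> sets P'})"
    unfolding indep_var_eq by auto
  have hist: "sets (seed_history M D \<xi> k) = sigma_sets (space M) {H -` A \<inter> space M |A. A \<in> sets P}"
    by (simp add: seed_history_def sets_vimage_algebra H_def P_def)
  show ?thesis
  proof (rule pair_measure_eqI)
    fix A B assume A: "A \<in> sets (distr M N Z)" and B: "B \<in> sets D"
    have a: "Z -` A \<inter> space M \<in> sigma_sets (space M) {H -` A \<inter> space M |A. A \<in> sets P}"
    proof -
      have "A \<in> sets N" using A by simp
      from measurable_sets[OF Z this] show ?thesis unfolding hist space_seed_history .
    qed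
    have coord: "(\<lambda>s. s k i) \<in> measurable P' D"
      unfolding P'_def
      using measurable_compose[OF measurable_component_singleton[of k "{k}" "\<lambda>_. \<Pi>\<^sub>M i\<in>(UNIV :: 'n set). D"]
          measurable_component_singleton[of i UNIV "\<lambda>_. D"]] by simp
    have "\<xi> k i -` B \<inter> space M = H' -` ((\<lambda>s. s k i) -` B \<inter> space P') \<inter> space M"
      using measurable_space[OF H'_rv] by (auto simp: H'_def)
    then have b: "\<xi> k i -` B \<inter> space M \<in> sigma_sets (space M) {H' -` A \<inter> space M |A. A \<in> sets P'}"
      using measurable_sets[OF coord B] by (blast intro: sigma_sets.Basic)
    have "emeasure (distr M N Z) A * emeasure D B
        = emeasure M (Z -` A \<inter> space M) * emeasure (distr M D (\<xi> k i)) B"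
      using A by (simp add: emeasure_distr law)
    also have "\<dots> = ennreal (prob (Z -` A \<inter> space M) * prob (\<xi> k i -` B \<inter> space M))"
      using B by (simp add: emeasure_distr emeasure_eq_measure ennreal_mult)
    also have "\<dots> = emeasure M ((Z -` A \<inter> space M) \<inter> (\<xi> k i -` B \<inter> space M))"
      using indep_setD[OF ind a b] by (simp add: emeasure_eq_measure)
    also have "\<dots> = emeasure (distr M (N \<Otimes>\<^sub>M D) (\<lambda>\<omega>. (Z \<omega>, \<xi> k i \<omega>))) (A \<times> B)"
      using A B by (subst emeasure_distr) (auto intro!: arg_cong[where f = "emeasure M"])
    finally show "emeasure (distr M N Z) A * emeasure D B
        = emeasure (distr M (N \<Otimes>\<^sub>M D) (\<lambda>\<omega>. (Z \<omega>, \<xi> k i \<omega>))) (A \<times> B)" .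
  qed (auto intro: D.sigma_finite_measure_axioms ZN.sigma_finite_measure_axioms
       simp: sets_pair_measure_cong[OF sets_distr refl])
qed

text \<open>The compressor bound is stated for fixed inputs. For a random input that is independent of the seed,
  integrate over the seed first.\<close>

lemma compression_error_independent_input:
  fixes Q :: "'s \<Rightarrow> real^'d \<Rightarrow> real^'d"
  assumes comp: "compressor \<delta> D Q" and [measurable]: "Z \<in> borel_measurable M" "S \<in> measurable M D"
    and joint: "distr M borel Z \<Otimes>\<^sub>M D = distr M (borel \<Otimes>\<^sub>M D) (\<lambda>\<omega>. (Z \<omega>, S \<omega>))"
  shows "(\<integral>\<^sup>+\<omega>. ennreal ((norm (Q (S \<omega>) (Z \<omega>) - Z \<omega>))\<^sup>2) \<partial>M)
    \<le> (\<integral>\<^sup>+\<omega>. ennreal (\<delta> * (norm (Z \<omega>))\<^sup>2) \<partial>M)"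
proof -
  interpret D: prob_space D using comp by (simp add: compressor_def)
  have Q: "(\<lambda>(s, x). Q s x) \<in> borel_measurable (D \<Otimes>\<^sub>M borel)"
    and bound: "\<And>x. (\<integral>\<^sup>+ s. ennreal ((norm (Q s x - x))\<^sup>2) \<partial>D) \<le> ennreal (\<delta> * (norm x)\<^sup>2)"
    using comp by (auto simp: compressor_def)
  define h where "h = (\<lambda>(x, s). ennreal ((norm (Q s x - x))\<^sup>2))"
  have [measurable]: "(\<lambda>(x, s). Q s x) \<in> borel_measurable (borel \<Otimes>\<^sub>M D)"
    using measurable_compose[OF measurable_pair_swap' Q] by (simp add: case_prod_beta comp_def)
  have h [measurable]: "h \<in> borel_measurable (borel \<Otimes>\<^sub>M D)"
    unfolding h_def case_prod_beta by measurable
  have "(\<integral>\<^sup>+\<omega>. ennreal ((norm (Q (S \<omega>) (Z \<omega>) - Z \<omega>))\<^sup>2) \<partial>M) = (\<integral>\<^sup>+\<omega>. h (Z \<omega>, S \<omega>) \<partial>M)"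
    by (simp add: h_def)
  also have "\<dots> = (\<integral>\<^sup>+p. h p \<partial>distr M (borel \<Otimes>\<^sub>M D) (\<lambda>\<omega>. (Z \<omega>, S \<omega>)))"
    by (subst nn_integral_distr) auto
  also have "\<dots> = (\<integral>\<^sup>+x. \<integral>\<^sup>+s. h (x, s) \<partial>D \<partial>distr M borel Z)"
    unfolding joint[symmetric]
    by (rule D.nn_integral_fst[symmetric])
       (simp add: measurable_cong_sets[OF sets_pair_measure_cong[OF sets_distr refl] refl])
  also have "\<dots> \<le> (\<integral>\<^sup>+x. ennreal (\<delta> * (norm x)\<^sup>2) \<partial>distr M borel Z)"
    using bound by (intro nn_integral_mono) (simp add: h_def)
  also have "\<dots> = (\<integral>\<^sup>+\<omega>. ennreal (\<delta> * (norm (Z \<omega>))\<^sup>2) \<partial>M)"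
    by (subst nn_integral_distr) auto
  finally show ?thesis .
qed

definition square_integrable :: "'w measure \<Rightarrow> ('w \<Rightarrow> 'a::euclidean_space) \<Rightarrow> bool" where
  "square_integrable M Z \<longleftrightarrow> Z \<in> borel_measurable M \<and> integrable M (\<lambda>\<omega>. (norm (Z \<omega>))\<^sup>2)"

lemma square_integrable_dominated:
  assumes "finite_measure M" and Z: "square_integrable M Z" and U: "U \<in> borel_measurable M"
    and le: "\<And>\<omega>. \<omega> \<in> space M \<Longrightarrow> norm (U \<omega>) \<le> K * norm (Z \<omega>) + C"
  shows "square_integrable M U"
proof -
  interpret finite_measure M by fact
  have "integrable M (\<lambda>\<omega>. 2 * K\<^sup>2 * (norm (Z \<omega>))\<^sup>2 + 2 * C\<^sup>2)"
    using Z by (auto simp: square_integrable_def)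
  then have "integrable M (\<lambda>\<omega>. (norm (U \<omega>))\<^sup>2)"
  proof (rule Bochner_Integration.integrable_bound)
    show "AE \<omega> in M. norm ((norm (U \<omega>))\<^sup>2) \<le> norm (2 * K\<^sup>2 * (norm (Z \<omega>))\<^sup>2 + 2 * C\<^sup>2)"
    proof (rule AE_I2)
      fix \<omega> assume "\<omega> \<in> space M"
      then have "(norm (U \<omega>))\<^sup>2 \<le> (K * norm (Z \<omega>) + C)\<^sup>2"
        by (intro power_mono le) auto
      also have "\<dots> \<le> 2 * K\<^sup>2 * (norm (Z \<omega>))\<^sup>2 + 2 * C\<^sup>2"
        using norm_add_square_le[of "K * norm (Z \<omega>)" C] by (simp add: power_mult_distrib)
      finally show "norm ((norm (U \<omega>))\<^sup>2) \<le> norm (2 * K\<^sup>2 * (norm (Z \<omega>))\<^sup>2 + 2 * C\<^sup>2)" by simp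
    qed
  qed (use U in simp)
  then show ?thesis using U by (simp add: square_integrable_def)
qed

lemma square_integrable_add:
  assumes A: "square_integrable M A" and B: "square_integrable M B"
  shows "square_integrable M (\<lambda>\<omega>. A \<omega> + B \<omega>)"
proof -
  have [measurable]: "A \<in> borel_measurable M" "B \<in> borel_measurable M"
    using A B by (auto simp: square_integrable_def)
  have "integrable M (\<lambda>\<omega>. 2 * (norm (A \<omega>))\<^sup>2 + 2 * (norm (B \<omega>))\<^sup>2)"
    using A B by (auto simp: square_integrable_def)
  then have "integrable M (\<lambda>\<omega>. (norm (A \<omega> + B \<omega>))\<^sup>2)"
    by (rule Bochner_Integration.integrable_bound) (auto intro!: AE_I2 norm_add_square_le)
  then show ?thesis by (simp add: square_integrable_def)
qed

lemma square_integrable_const: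
  assumes "finite_measure M"
  shows "square_integrable M (\<lambda>\<omega>. c)"
proof -
  interpret finite_measure M by fact
  show ?thesis by (simp add: square_integrable_def)
qed

lemma square_integrable_diff:
  assumes "square_integrable M A" "square_integrable M B"
  shows "square_integrable M (\<lambda>\<omega>. A \<omega> - B \<omega>)"
  using square_integrable_add[of M A "\<lambda>\<omega>. - B \<omega>"] assms by (simp add: square_integrable_def)

lemma square_integrable_scaleR:
  assumes "square_integrable M A"
  shows "square_integrable M (\<lambda>\<omega>. c *\<^sub>R A \<omega>)"
  using assms by (auto simp: square_integrable_def power_mult_distrib)

lemma square_integrable_cong:
  assumes "\<And>\<omega>. \<omega> \<in> space M \<Longrightarrow> A \<omega> = B \<omega>"
  shows "square_integrable M A \<longleftrightarrow> square_integrable M B"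
  unfolding square_integrable_def using assms
  by (intro conj_cong measurable_cong Bochner_Integration.integrable_cong) auto

text \<open>The rows may use dependent seeds: the squared Frobenius norm is a sum over rows, and each row needs only
  the independence of its own seed from the past.\<close>

lemma fresh_compression:
  fixes Q :: "'s \<Rightarrow> real^'d \<Rightarrow> real^'d" and \<xi> :: "nat \<Rightarrow> 'n::finite \<Rightarrow> 'w \<Rightarrow> 's"
    and Z :: "'w \<Rightarrow> real^'d^'n"
  assumes seeds: "fresh_seeds M D \<xi>" and comp: "compressor \<delta> D Q" and \<delta>: "0 \<le> \<delta>"
    and Z: "Z \<in> borel_measurable (seed_history M D \<xi> k)" "square_integrable M Z"
  defines "C \<equiv> \<lambda>\<omega>. rowwise (\<lambda>i. Q (\<xi> k i \<omega>)) (Z \<omega>)"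
  shows "C \<in> borel_measurable (seed_history M D \<xi> (Suc k))"
    and "square_integrable M (\<lambda>\<omega>. C \<omega> - Z \<omega>)" and "square_integrable M C"
    and "(\<integral>\<omega>. (norm (C \<omega> - Z \<omega>))\<^sup>2 \<partial>M) \<le> \<delta> * (\<integral>\<omega>. (norm (Z \<omega>))\<^sup>2 \<partial>M)"
proof -
  have Qm: "(\<lambda>(s, x). Q s x) \<in> borel_measurable (D \<Otimes>\<^sub>M borel)" using comp by (simp add: compressor_def)
  show Cm: "C \<in> borel_measurable (seed_history M D \<xi> (Suc k))"
  proof (rule borel_measurable_rowsI)
    fix i
    have "(\<lambda>\<omega>. (\<xi> k i \<omega>, Z \<omega> $ i)) \<in> measurable (seed_history M D \<xi> (Suc k)) (D \<Otimes>\<^sub>M borel)"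
      by (intro measurable_Pair seed_measurable_history seeds borel_measurable_row
          seed_history_mono[OF seeds Z(1)]) auto
    from measurable_compose[OF this Qm]
    show "(\<lambda>\<omega>. C \<omega> $ i) \<in> borel_measurable (seed_history M D \<xi> (Suc k))" by (simp add: C_def)
  qed
  have [measurable]: "C \<in> borel_measurable M" "Z \<in> borel_measurable M"
    using seed_history_sub[OF seeds Cm] seed_history_sub[OF seeds Z(1)] .
  note [measurable] = borel_measurable_row
  have "(\<integral>\<^sup>+\<omega>. ennreal ((norm (C \<omega> - Z \<omega>))\<^sup>2) \<partial>M)
      = (\<integral>\<^sup>+\<omega>. (\<Sum>i\<in>UNIV. ennreal ((norm (C \<omega> $ i - Z \<omega> $ i))\<^sup>2)) \<partial>M)"
    by (simp add: norm_rows_square sum_ennreal)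
  also have "\<dots> = (\<Sum>i\<in>UNIV. \<integral>\<^sup>+\<omega>. ennreal ((norm (C \<omega> $ i - Z \<omega> $ i))\<^sup>2) \<partial>M)"
    by (rule nn_integral_sum) measurable
  also have "\<dots> \<le> (\<Sum>i\<in>UNIV. \<integral>\<^sup>+\<omega>. ennreal (\<delta> * (norm (Z \<omega> $ i))\<^sup>2) \<partial>M)"
  proof (rule sum_mono)
    fix i
    have "distr M borel (\<lambda>\<omega>. Z \<omega> $ i) \<Otimes>\<^sub>M D = distr M (borel \<Otimes>\<^sub>M D) (\<lambda>\<omega>. (Z \<omega> $ i, \<xi> k i \<omega>))"
      by (intro joint_law_history_seed seeds borel_measurable_row Z(1))
    from compression_error_independent_input[OF comp _ _ this]
    show "(\<integral>\<^sup>+\<omega>. ennreal ((norm (C \<omega> $ i - Z \<omega> $ i))\<^sup>2) \<partial>M)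
        \<le> (\<integral>\<^sup>+\<omega>. ennreal (\<delta> * (norm (Z \<omega> $ i))\<^sup>2) \<partial>M)" using seeds by (simp add: C_def fresh_seeds_def)
  qed
  also have "\<dots> = (\<integral>\<^sup>+\<omega>. (\<Sum>i\<in>UNIV. ennreal (\<delta> * (norm (Z \<omega> $ i))\<^sup>2)) \<partial>M)"
    by (rule nn_integral_sum[symmetric]) measurable
  also have "\<dots> = (\<integral>\<^sup>+\<omega>. ennreal (\<delta> * (norm (Z \<omega>))\<^sup>2) \<partial>M)"
    using \<delta> by (simp add: norm_rows_square sum_distrib_left)
  also have "\<dots> = ennreal (\<delta> * (\<integral>\<omega>. (norm (Z \<omega>))\<^sup>2 \<partial>M))"
    using \<delta> Z(2) by (subst nn_integral_eq_integral) (auto simp: square_integrable_def)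
  finally have le: "(\<integral>\<^sup>+\<omega>. ennreal ((norm (C \<omega> - Z \<omega>))\<^sup>2) \<partial>M) \<le> ennreal (\<delta> * (\<integral>\<omega>. (norm (Z \<omega>))\<^sup>2 \<partial>M))" .
  have int: "integrable M (\<lambda>\<omega>. (norm (C \<omega> - Z \<omega>))\<^sup>2)"
  proof (rule integrableI_bounded)
    show "(\<integral>\<^sup>+\<omega>. ennreal (norm ((norm (C \<omega> - Z \<omega>))\<^sup>2)) \<partial>M) < \<infinity>"
      using le_less_trans[OF le ennreal_less_top] by simp
  qed measurable
  then show diff: "square_integrable M (\<lambda>\<omega>. C \<omega> - Z \<omega>)" by (simp add: square_integrable_def)
  show "square_integrable M C" using square_integrable_add[OF diff Z(2)] by simp
  show "(\<integral>\<omega>. (norm (C \<omega> - Z \<omega>))\<^sup>2 \<partial>M) \<le> \<delta> * (\<integral>\<omega>. (norm (Z \<omega>))\<^sup>2 \<partial>M)"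
    using le \<delta> by (subst (asm) nn_integral_eq_integral[OF int]) (auto simp: ennreal_le_iff integral_nonneg_AE)
qed

text \<open>The class of random matrices that is preserved by every operation of the algorithm: functions of the
  seeds before round \<open>k\<close> with finite second moment. Measurability in the past is what makes the next
  compression error independent of its input, and the second moment makes the Lyapunov values integrable.\<close>

definition L2_adapted ::
  "'w measure \<Rightarrow> 's measure \<Rightarrow> (nat \<Rightarrow> 'n::finite \<Rightarrow> 'w \<Rightarrow> 's) \<Rightarrow> nat \<Rightarrow> ('w \<Rightarrow> 'a::euclidean_space) \<Rightarrow> bool" where
  "L2_adapted M D \<xi> k Z \<longleftrightarrow> Z \<in> borel_measurable (seed_history M D \<xi> k) \<and> square_integrable M Z"

context
  fixes M :: "'w measure" and D :: "'s measure" and \<xi> :: "nat \<Rightarrow> 'n::finite \<Rightarrow> 'w \<Rightarrow> 's"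
  assumes seeds: "fresh_seeds M D \<xi>"
begin

lemma seeds_finite_measure: "finite_measure M"
  using seeds by (auto simp: fresh_seeds_def prob_space_def)

lemma L2_adapted_cong:
  assumes "\<And>\<omega>. \<omega> \<in> space M \<Longrightarrow> A \<omega> = C \<omega>"
  shows "L2_adapted M D \<xi> k A \<longleftrightarrow> L2_adapted M D \<xi> k C"
  unfolding L2_adapted_def using assms
  by (intro conj_cong measurable_cong square_integrable_cong) auto

lemma L2_adapted_mono: "L2_adapted M D \<xi> k Z \<Longrightarrow> k \<le> l \<Longrightarrow> L2_adapted M D \<xi> l Z"
  using seed_history_mono[OF seeds] by (auto simp: L2_adapted_def)

lemma L2_adapted_const: "L2_adapted M D \<xi> k (\<lambda>\<omega>. c)"
  using square_integrable_const[OF seeds_finite_measure] by (auto simp: L2_adapted_def)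

lemma L2_adapted_add: "L2_adapted M D \<xi> k A \<Longrightarrow> L2_adapted M D \<xi> k C \<Longrightarrow> L2_adapted M D \<xi> k (\<lambda>\<omega>. A \<omega> + C \<omega>)"
  using square_integrable_add by (auto simp: L2_adapted_def)

lemma L2_adapted_diff: "L2_adapted M D \<xi> k A \<Longrightarrow> L2_adapted M D \<xi> k C \<Longrightarrow> L2_adapted M D \<xi> k (\<lambda>\<omega>. A \<omega> - C \<omega>)"
  using square_integrable_diff by (auto simp: L2_adapted_def)

lemma L2_adapted_scaleR: "L2_adapted M D \<xi> k A \<Longrightarrow> L2_adapted M D \<xi> k (\<lambda>\<omega>. c *\<^sub>R A \<omega>)"
  using square_integrable_scaleR by (auto simp: L2_adapted_def)

lemma L2_adapted_lipschitz:
  fixes T :: "'a::euclidean_space \<Rightarrow> 'b::euclidean_space"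
  assumes A: "L2_adapted M D \<xi> k A" and T: "\<And>x y. norm (T x - T y) \<le> K * norm (x - y)" and "0 \<le> K"
  shows "L2_adapted M D \<xi> k (\<lambda>\<omega>. T (A \<omega>))"
proof -
  have "K-lipschitz_on UNIV T"
    using T \<open>0 \<le> K\<close> by (intro lipschitz_onI) (auto simp: dist_norm)
  then have "T \<in> borel_measurable borel"
    by (intro borel_measurable_continuous_onI lipschitz_on_continuous_on)
  then have meas: "(\<lambda>\<omega>. T (A \<omega>)) \<in> borel_measurable (seed_history M D \<xi> k)"
    using A measurable_compose[where N = borel and f = A and g = T] by (auto simp: L2_adapted_def)
  have "norm (T (A \<omega>)) \<le> K * norm (A \<omega>) + norm (T 0)" for \<omega>
    using T[of "A \<omega>" 0, unfolded diff_zero] norm_triangle_ineq2[of "T (A \<omega>)" "T 0"] by linarith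
  then have "square_integrable M (\<lambda>\<omega>. T (A \<omega>))"
    using A seed_history_sub[OF seeds meas] square_integrable_dominated[OF seeds_finite_measure]
    unfolding L2_adapted_def by blast
  then show ?thesis using meas by (simp add: L2_adapted_def)
qed

lemma L2_adapted_linear:
  fixes T :: "'a::euclidean_space \<Rightarrow> 'b::euclidean_space"
  assumes A: "L2_adapted M D \<xi> k A" and T: "linear T"
  shows "L2_adapted M D \<xi> k (\<lambda>\<omega>. T (A \<omega>))"
proof -
  interpret bounded_linear T using T by (simp add: linear_conv_bounded_linear)
  obtain K where "0 \<le> K" "\<And>x. norm (T x) \<le> norm x * K" using nonneg_bounded by blast
  then show ?thesis
    by (intro L2_adapted_lipschitz[OF A, of T K]) (simp_all add: diff[symmetric] mult.commute)
qed

lemma L2_adapted_compression: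
  assumes "compressor \<delta> D Q" "0 \<le> \<delta>" and Z: "L2_adapted M D \<xi> k Z"
  shows "L2_adapted M D \<xi> (Suc k) (\<lambda>\<omega>. rowwise (\<lambda>i. Q (\<xi> k i \<omega>)) (Z \<omega>))"
  using fresh_compression[OF seeds assms(1,2)] Z by (auto simp: L2_adapted_def)

end

lemma integrable_inner_square_integrable:
  assumes A: "square_integrable M A" and C: "square_integrable M C"
  shows "integrable M (\<lambda>\<omega>. A \<omega> \<bullet> C \<omega>)"
  unfolding dot_norm using A C square_integrable_add[OF A C] by (simp add: square_integrable_def)

lemma integrable_wnorm2:
  fixes A :: "'w \<Rightarrow> real^'d^'n"
  assumes M: "finite_measure M" and A: "square_integrable M A"
  shows "integrable M (\<lambda>\<omega>. wnorm2 N (A \<omega>))"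
proof -
  have lin: "bounded_linear (\<lambda>a :: real^'d^'n. N ** a)"
    using linear_matrix_mult by (simp add: linear_conv_bounded_linear)
  then obtain K where K: "\<And>a :: real^'d^'n. norm (N ** a) \<le> norm a * K" using bounded_linear.bounded by blast
  have "(\<lambda>\<omega>. N ** A \<omega>) \<in> borel_measurable M"
  proof (rule measurable_compose[where N = borel and f = A and g = "\<lambda>a :: real^'d^'n. N ** a"])
    show "A \<in> borel_measurable M" using A by (simp add: square_integrable_def)
    show "(\<lambda>a :: real^'d^'n. N ** a) \<in> borel_measurable borel"
      by (intro borel_measurable_continuous_onI linear_continuous_on lin)
  qed
  moreover have "norm (N ** A \<omega>) \<le> K * norm (A \<omega>) + 0" for \<omega>
    using K[of "A \<omega>"] by (simp add: mult.commute)
  ultimately have "square_integrable M (\<lambda>\<omega>. N ** A \<omega>)"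
    by (rule square_integrable_dominated[OF M A])
  then show ?thesis unfolding wnorm2_eq_inner by (rule integrable_inner_square_integrable[OF A])
qed

section \<open>The COLD recursion along one realization\<close>

text \<open>The dual variable starts at 0 and only ever receives increments in the range of \<open>I - W\<close>.\<close>

lemma cold_dual_in_range:
  assumes "cold_iteration \<gamma> \<tau> W gf C X0 X Y Yh \<Psi>"
  shows "\<exists>U. \<Psi> k = (mat 1 - W) ** U"
proof (induction k)
  case 0
  then show ?case using assms by (intro exI[of _ 0]) (simp add: cold_iteration_def linear_0[OF linear_matrix_mult])
next
  case (Suc k)
  show ?case
  proof (cases "k = 0")
    case True
    then show ?thesis using assms
      by (intro exI[of _ 0]) (simp add: cold_iteration_def linear_0[OF linear_matrix_mult])
  next
    case False
    obtain U where "\<Psi> k = (mat 1 - W) ** U" using Suc by blast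
    then have "\<Psi> (Suc k) = (mat 1 - W) ** (U + \<tau> *\<^sub>R Yh (Suc k))"
      using assms False
      by (simp add: cold_iteration_def linear_add[OF linear_matrix_mult] linear_cmul[OF linear_matrix_mult])
    then show ?thesis by blast
  qed
qed

lemma cold_round:
  assumes "cold_iteration \<gamma> \<tau> W gf C X0 X Y Yh \<Psi>" "1 \<le> k"
  shows "Y k = X k - \<gamma> *\<^sub>R rowwise gf (X k) - \<gamma> *\<^sub>R \<Psi> k"
    and "Yh (Suc k) = Yh k + C k (Y k - Yh k)"
    and "\<Psi> (Suc k) = \<Psi> k + \<tau> *\<^sub>R ((mat 1 - W) ** Yh (Suc k))"
    and "X (Suc k) = X k - \<gamma> *\<^sub>R rowwise gf (X k) - \<gamma> *\<^sub>R \<Psi> (Suc k)"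
  using assms unfolding cold_iteration_def Suc_eq_plus1 by blast+

text \<open>The compressed vector differs from the next iterate by the dual increment. At \<open>k = 0\<close> this is the
  initialization, because \<open>\<Psi> 0 = \<Psi> 1\<close>.\<close>

lemma cold_message:
  assumes "cold_iteration \<gamma> \<tau> W gf C X0 X Y Yh \<Psi>"
  shows "Y k = X (Suc k) + \<gamma> *\<^sub>R (\<Psi> (Suc k) - \<Psi> k)"
proof (cases "k = 0")
  case True
  then show ?thesis using assms by (simp add: cold_iteration_def)
next
  case False
  then have "1 \<le> k" by simp
  from cold_round(1,4)[OF assms this] show ?thesis by (simp only: scaleR_diff_right) (simp add: algebra_simps)
qed

text \<open>Inside this locale everything is deterministic: the compressor occurs only through the iterates of one
  realization, and its error is an arbitrary matrix.\<close>

locale cold =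
  fixes W :: "real^'n^'n" and f :: "'n \<Rightarrow> real^'d \<Rightarrow> real" and gf :: "'n \<Rightarrow> real^'d \<Rightarrow> real^'d"
    and xstar :: "real^'d" and Xstar \<Psi>star :: "real^'d^'n" and \<Theta> :: "real^'n^'n"
    and \<mu> L \<delta> \<delta>' \<gamma> \<tau> \<rho> \<sigma> :: real
  assumes card: "2 \<le> CARD('n)"
    and W_sym: "transpose W = W"
    and W_null: "{v. (mat 1 - W) *v v = 0} = span {vec 1}"
    and W_le: "loewner_le W (mat 1)"
    and mu_L: "0 < \<mu>" "\<mu> \<le> L"
    and cost: "cost_assumption \<mu> L f gf"
    and xstar: "is_arg_min (\<lambda>x. \<Sum>i\<in>UNIV. f i x) (\<lambda>x. True) xstar"
    and delta: "0 \<le> \<delta>" "\<delta> < 1"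
    and delta': "\<delta>' = 4 * sqrt \<delta> / (1 - \<delta>)" "\<delta>' < 1"
    and gamma: "0 < \<gamma>" "\<gamma> < (1 - \<delta>) / (\<mu> + L)"
    and tau: "0 < \<tau>" "\<tau> < (1 - \<delta>) / (2 * \<gamma> * (1 - nth_largest_eigenvalue CARD('n) W))"
    and Xstar: "Xstar = (\<chi> i. xstar)"
    and Psistar: "\<Psi>star = - rowwise gf Xstar"
    and Theta: "\<Theta> = (1 / \<tau>) *\<^sub>R pseudoinverse (mat 1 - W) - mat \<gamma>"
    and rho: "\<rho> = 1 - nth_largest_eigenvalue 2 W"
    and sigma: "\<sigma> = max (1 - 2 * \<mu> * L * \<gamma> / (\<mu> + L)) (1 - \<gamma> * \<tau> * \<rho> * (1 - sqrt \<delta>'))"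
begin

abbreviation (input) B :: "real^'n^'n" where "B \<equiv> mat 1 - W"

abbreviation (input) \<Lambda> :: real where "\<Lambda> \<equiv> 1 - nth_largest_eigenvalue CARD('n) W"

definition c :: real where "c = (1 + \<delta> - 4 * sqrt \<delta>) / (2 * \<gamma> * sqrt (\<delta> * \<delta>'))"

text \<open>The weight \<open>c\<close> of the compression error in the Lyapunov function plus the constant
  \<open>2 / (\<gamma> sqrt \<delta>')\<close> of Young's inequality.\<close>

definition \<kappa> :: real where "\<kappa> = (1 + \<delta>) / (2 * \<gamma> * sqrt (\<delta> * \<delta>'))"

lemmas spectral = laplacian_spectral_bounds[OF card W_sym W_null W_le, folded rho]

lemma B_sym: "transpose B = B"
  using W_sym by (simp add: transpose_def vec_eq_iff mat_def)

lemma step_size: "\<gamma> * \<tau> * \<Lambda> \<le> (1 - \<delta>) / 2"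
proof -
  have "0 < \<Lambda>" using spectral(1,2) by linarith
  then have "\<tau> * (2 * \<gamma> * \<Lambda>) < 1 - \<delta>" using tau(2) gamma(1) by (simp add: pos_less_divide_eq)
  then show ?thesis by (simp add: mult_ac)
qed

lemma theta_rho: "0 < \<gamma> * \<tau> * \<rho>" "\<gamma> * \<tau> * \<rho> \<le> (1 - \<delta>) / 2"
proof -
  show "0 < \<gamma> * \<tau> * \<rho>" using gamma tau spectral(1) by simp
  have "\<gamma> * \<tau> * \<rho> \<le> \<gamma> * \<tau> * \<Lambda>" using gamma tau spectral(2) by (intro mult_left_mono) auto
  then show "\<gamma> * \<tau> * \<rho> \<le> (1 - \<delta>) / 2" using step_size by linarith
qed

lemma root_bounds: "0 \<le> sqrt \<delta>'" "sqrt \<delta>' < 1"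
  using delta delta' by simp_all

lemma sigma_lower:
  "1 - 2 * \<mu> * L * \<gamma> / (\<mu> + L) \<le> \<sigma>" "1 - \<gamma> * \<tau> * \<rho> * (1 - sqrt \<delta>') \<le> \<sigma>"
  "1 - (1 - \<delta>) / 2 * (1 - sqrt \<delta>') \<le> \<sigma>"
proof -
  show "1 - 2 * \<mu> * L * \<gamma> / (\<mu> + L) \<le> \<sigma>" and *: "1 - \<gamma> * \<tau> * \<rho> * (1 - sqrt \<delta>') \<le> \<sigma>"
    by (simp_all add: sigma)
  have "\<gamma> * \<tau> * \<rho> * (1 - sqrt \<delta>') \<le> (1 - \<delta>) / 2 * (1 - sqrt \<delta>')"
    using theta_rho root_bounds by (intro mult_right_mono) auto
  then show "1 - (1 - \<delta>) / 2 * (1 - sqrt \<delta>') \<le> \<sigma>" using * by linarith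
qed

lemma sigma_less_1: "\<sigma> < 1"
proof -
  have "0 < 2 * \<mu> * L * \<gamma> / (\<mu> + L)" using mu_L gamma by simp
  moreover have "0 < \<gamma> * \<tau> * \<rho> * (1 - sqrt \<delta>')" using theta_rho root_bounds by simp
  ultimately show ?thesis by (simp add: sigma)
qed

lemmas weights = noise_weights[OF delta delta' gamma(1) sigma_lower(3), folded c_def \<kappa>_def]

text \<open>On the range of \<open>B\<close> the form of the pseudoinverse pulls back to the form of \<open>B\<close>, since \<open>B P B = B\<close>. All
  later facts about \<open>\<Theta>\<close> come from this formula.\<close>

lemma Theta_form:
  "(B ** U) \<bullet> (\<Theta> ** (B ** U')) = (1 / \<tau>) * (U \<bullet> (B ** U')) - \<gamma> * ((B ** U) \<bullet> (B ** U'))"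
  for U U' :: "real^'d^'n"
proof -
  define P where "P = pseudoinverse B"
  have P: "B ** P ** B = B"
    using symmetric_pseudoinverse[OF B_sym] by (simp add: is_pseudoinverse_def P_def)
  have "(B ** U) \<bullet> (P ** (B ** U')) = U \<bullet> (B ** (P ** (B ** U')))"
    by (rule frobenius_adjoint[OF B_sym])
  also have "\<dots> = U \<bullet> (B ** U')" using P by (simp only: matrix_mul_assoc)
  finally have "(B ** U) \<bullet> (P ** (B ** U')) = U \<bullet> (B ** U')" .
  moreover have "\<Theta> ** (B ** U') = (1 / \<tau>) *\<^sub>R (P ** (B ** U')) - \<gamma> *\<^sub>R (B ** U')"
    unfolding Theta P_def[symmetric]
    by (simp only: matrix_mult_diff_left scaleR_matrix_mult mat_mult_scaleR)
  ultimately show ?thesis by (simp add: inner_diff_right)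
qed

lemma Theta_form_sym:
  "(B ** U) \<bullet> (\<Theta> ** (B ** U')) = (B ** U') \<bullet> (\<Theta> ** (B ** U))" for U U' :: "real^'d^'n"
proof -
  have "U \<bullet> (B ** U') = U' \<bullet> (B ** U)"
    using frobenius_adjoint[OF B_sym, of U U'] by (simp add: inner_commute)
  then show ?thesis unfolding Theta_form by (simp add: inner_commute)
qed

text \<open>With \<open>u = (U, B U)\<close> the norm of \<open>A = B U\<close> in \<open>\<Theta> + \<gamma>\<close> is \<open>u/\<tau>\<close>, and the spectral bounds say
  \<open>\<rho> u \<le> |A|\<^sup>2 \<le> \<Lambda> u\<close>.\<close>

lemma Theta_bounds:
  fixes U :: "real^'d^'n"
  defines "A \<equiv> B ** U"
  shows "(1 + \<delta>) / (1 - \<delta>) * \<gamma> * (norm A)\<^sup>2 \<le> wnorm2 \<Theta> A"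
    and "\<gamma> * \<tau> * \<rho> * (wnorm2 \<Theta> A + \<gamma> * (norm A)\<^sup>2) \<le> \<gamma> * (norm A)\<^sup>2"
proof -
  define u where "u = U \<bullet> A"
  have q: "wnorm2 \<Theta> A + \<gamma> * (norm A)\<^sup>2 = u / \<tau>"
    unfolding wnorm2_eq_inner A_def Theta_form u_def power2_norm_eq_inner by simp
  have low: "(norm A)\<^sup>2 \<le> \<Lambda> * u" and up: "\<rho> * u \<le> (norm A)\<^sup>2"
    using spectral(3,4)[of U] by (simp_all add: A_def u_def)
  have "0 < \<Lambda>" using spectral(1,2) by linarith
  have u0: "0 \<le> u"
  proof -
    have "0 \<le> \<Lambda> * u" using low zero_le_power2 order_trans by blast
    then show ?thesis using \<open>0 < \<Lambda>\<close> by (simp add: zero_le_mult_iff)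
  qed
  have "\<gamma> * \<tau> * \<rho> * (u / \<tau>) = \<gamma> * (\<rho> * u)" using tau(1) by simp
  also have "\<dots> \<le> \<gamma> * (norm A)\<^sup>2" using up gamma(1) by simp
  finally show "\<gamma> * \<tau> * \<rho> * (wnorm2 \<Theta> A + \<gamma> * (norm A)\<^sup>2) \<le> \<gamma> * (norm A)\<^sup>2" unfolding q .
  have "2 / (1 - \<delta>) * \<gamma> * (norm A)\<^sup>2 \<le> 2 / (1 - \<delta>) * \<gamma> * (\<Lambda> * u)"
    using low gamma(1) delta by (intro mult_left_mono) auto
  also have "\<dots> = 2 / (1 - \<delta>) * (\<gamma> * \<tau> * \<Lambda>) * (u / \<tau>)" using tau(1) by simp
  also have "\<dots> \<le> 2 / (1 - \<delta>) * ((1 - \<delta>) / 2) * (u / \<tau>)"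
    using step_size delta tau(1) u0 by (intro mult_right_mono mult_left_mono) auto
  also have "2 / (1 - \<delta>) * ((1 - \<delta>) / 2) = 1" using delta by (simp add: divide_simps)
  finally have "2 / (1 - \<delta>) * \<gamma> * (norm A)\<^sup>2 \<le> wnorm2 \<Theta> A + \<gamma> * (norm A)\<^sup>2" unfolding q by simp
  moreover have "(1 + \<delta>) / (1 - \<delta>) = 2 / (1 - \<delta>) - 1" using delta by (simp add: field_simps)
  ultimately show "(1 + \<delta>) / (1 - \<delta>) * \<gamma> * (norm A)\<^sup>2 \<le> wnorm2 \<Theta> A"
    by (simp add: left_diff_distrib)
qed

lemma consensus_null: "B ** Xstar = 0"
proof (rule matrix_eq_columns)
  fix j
  have "column j Xstar = (xstar $ j) *\<^sub>R vec 1" by (simp add: Xstar vec_eq_iff column_def)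
  then have "column j Xstar \<in> span {vec 1}" by (simp add: span_base span_scale)
  then have "B *v column j Xstar = 0" using W_null by blast
  then show "column j (B ** Xstar) = column j 0"
    unfolding column_mult by (simp add: column_def vec_eq_iff)
qed

text \<open>Optimality of \<open>xstar\<close>: the columns of \<open>\<Psi>star\<close> sum to zero, so they are orthogonal to the kernel of \<open>B\<close>.\<close>

lemma Psistar_in_range: "\<exists>U. \<Psi>star = B ** U"
proof -
  have "(\<Sum>i\<in>UNIV. gf i xstar) = 0"
    by (rule gradient_sum_zero_at_minimum[of f]) (use cost xstar in \<open>auto simp: cost_assumption_def\<close>)
  then have sum0: "(\<Sum>i\<in>UNIV. gf i xstar $ j) = 0" for j
    by (metis sum_component zero_index)
  have "B ** (pseudoinverse B ** \<Psi>star) = \<Psi>star"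
  proof (rule matrix_eq_columns)
    fix j
    have "z \<bullet> column j \<Psi>star = 0" if "B *v z = 0" for z
    proof -
      have "z \<in> span {vec 1}" using that W_null by blast
      then obtain a where "z = a *\<^sub>R vec 1" by (auto simp: span_singleton)
      then show ?thesis
        using sum0[of j] by (simp add: inner_vec_def column_def Psistar Xstar sum_negf sum_distrib_left[symmetric])
    qed
    then show "column j (B ** (pseudoinverse B ** \<Psi>star)) = column j \<Psi>star"
      unfolding column_mult by (intro symmetric_range B_sym) auto
  qed
  then show ?thesis by metis
qed

text \<open>Cocoercivity would allow steps up to \<open>2/(\<mu>+L)\<close>. The shorter step \<open>\<gamma> < (1-\<delta>)/(\<mu>+L)\<close> leaves a multiple of
  \<open>|g|\<^sup>2\<close> unused, which later pays for the share of the gradient in the compression error.\<close>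

lemma gradient_step_contraction:
  fixes X :: "real^'d^'n"
  defines "x \<equiv> X - Xstar" and "g \<equiv> rowwise gf X - rowwise gf Xstar"
  shows "(norm (x - \<gamma> *\<^sub>R g))\<^sup>2
    \<le> (1 - 2 * \<mu> * L * \<gamma> / (\<mu> + L)) * (norm x)\<^sup>2 - \<gamma>\<^sup>2 * ((1 + \<delta>) / (1 - \<delta>)) * (norm g)\<^sup>2"
proof -
  have pos: "0 < \<mu> + L" using mu_L by simp
  have "\<mu> * L * (norm x)\<^sup>2 + (norm g)\<^sup>2
      = (\<Sum>i\<in>UNIV. \<mu> * L * (norm (X $ i - xstar))\<^sup>2 + (norm (gf i (X $ i) - gf i xstar))\<^sup>2)"
    by (simp add: norm_rows_square x_def g_def Xstar sum.distrib sum_distrib_left)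
  also have "\<dots> \<le> (\<Sum>i\<in>UNIV. (\<mu> + L) * ((X $ i - xstar) \<bullet> (gf i (X $ i) - gf i xstar)))"
    using cost mu_L
    by (intro sum_mono strongly_convex_smooth_cocoercive) (auto simp: cost_assumption_def)
  also have "\<dots> = (\<mu> + L) * (x \<bullet> g)"
    unfolding inner_vec_def[of x g] by (simp add: x_def g_def Xstar sum_distrib_left)
  finally have "(\<mu> * L * (norm x)\<^sup>2 + (norm g)\<^sup>2) / (\<mu> + L) \<le> x \<bullet> g"
    using pos by (simp add: pos_divide_le_eq mult.commute)
  then have "2 * \<gamma> * ((\<mu> * L * (norm x)\<^sup>2 + (norm g)\<^sup>2) / (\<mu> + L)) \<le> 2 * \<gamma> * (x \<bullet> g)"
    using gamma(1) by (intro mult_left_mono) auto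
  then have coco: "2 * \<mu> * L * \<gamma> / (\<mu> + L) * (norm x)\<^sup>2 + 2 * \<gamma> * (1 / (\<mu> + L)) * (norm g)\<^sup>2 \<le> 2 * \<gamma> * (x \<bullet> g)"
    by (simp add: distrib_left add_divide_distrib mult_ac)
  have "\<gamma> / (1 - \<delta>) \<le> 1 / (\<mu> + L)"
    using gamma(2) pos delta by (simp add: field_simps)
  then have "2 * \<gamma> * (\<gamma> / (1 - \<delta>)) * (norm g)\<^sup>2 \<le> 2 * \<gamma> * (1 / (\<mu> + L)) * (norm g)\<^sup>2"
    using gamma(1) by (intro mult_right_mono mult_left_mono) auto
  moreover have "2 * \<gamma> * (\<gamma> / (1 - \<delta>)) = \<gamma>\<^sup>2 + \<gamma>\<^sup>2 * ((1 + \<delta>) / (1 - \<delta>))"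
    using delta by (simp add: field_simps power2_eq_square)
  ultimately have gap: "\<gamma>\<^sup>2 * (norm g)\<^sup>2 + \<gamma>\<^sup>2 * ((1 + \<delta>) / (1 - \<delta>)) * (norm g)\<^sup>2
      \<le> 2 * \<gamma> * (1 / (\<mu> + L)) * (norm g)\<^sup>2"
    by (simp only: distrib_right)
  have "(norm (x - \<gamma> *\<^sub>R g))\<^sup>2 = (norm x)\<^sup>2 - 2 * \<gamma> * (x \<bullet> g) + \<gamma>\<^sup>2 * (norm g)\<^sup>2"
    unfolding power2_norm_eq_inner
    by (simp add: inner_diff_left inner_diff_right inner_commute[of g x] power2_eq_square algebra_simps)
  then show ?thesis using coco gap by (simp add: left_diff_distrib)
qed

definition lyapunov :: "real^'d^'n \<Rightarrow> real^'d^'n \<Rightarrow> real^'d^'n \<Rightarrow> real^'d^'n \<Rightarrow> real^'d^'n \<Rightarrow> real" where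
  "lyapunov X Yh \<Psi> Y' \<Psi>' =
     wnorm2 (mat (1 / \<gamma>)) (X - Xstar)
   + wnorm2 (\<Theta> + mat ((1 - sqrt \<delta>' / 2) * \<gamma>)) (\<Psi> - \<Psi>star)
   + wnorm2 \<Theta> (\<Psi> - \<Psi>')
   + c * (norm (Yh - Y'))\<^sup>2"

text \<open>The bound for the next Lyapunov value if the compressor makes no error.\<close>

definition noiseless :: "real^'d^'n \<Rightarrow> real^'d^'n \<Rightarrow> real" where
  "noiseless X \<Psi> = (norm (X - Xstar - \<gamma> *\<^sub>R (rowwise gf X - rowwise gf Xstar)))\<^sup>2 / \<gamma>
     + wnorm2 \<Theta> (\<Psi> - \<Psi>star)"

lemma lyapunov_eq:
  "lyapunov X Yh \<Psi> Y' \<Psi>' = (norm (X - Xstar))\<^sup>2 / \<gamma>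
   + (wnorm2 \<Theta> (\<Psi> - \<Psi>star) + (1 - sqrt \<delta>' / 2) * \<gamma> * (norm (\<Psi> - \<Psi>star))\<^sup>2)
   + wnorm2 \<Theta> (\<Psi> - \<Psi>') + c * (norm (Yh - Y'))\<^sup>2"
  by (simp add: lyapunov_def wnorm2_add wnorm2_mat)

text \<open>The heart of the identity is \<open>cross\<close>: the dual update turns \<open>(\<psi>', \<Theta> d)\<close> into \<open>(\<psi>', x' + E')\<close>, because
  \<open>\<psi>'\<close> lies in the range of \<open>B\<close> and \<open>B Xstar = 0\<close>.\<close>

lemma lyapunov_step:
  assumes iter: "cold_iteration \<gamma> \<tau> W gf C X0 X Y Yh \<Psi>" and k: "1 \<le> k"
    and exact: "\<delta> = 0 \<Longrightarrow> Yh (Suc k) = Y k"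
  shows "lyapunov (X (Suc k)) (Yh (Suc k)) (\<Psi> (Suc k)) (Y k) (\<Psi> k)
     \<le> noiseless (X k) (\<Psi> k) + \<kappa> * (norm (Yh (Suc k) - Y k))\<^sup>2"
proof -
  define x' \<psi> \<psi>' d E' where "x' = X (Suc k) - Xstar" and "\<psi> = \<Psi> k - \<Psi>star"
    and "\<psi>' = \<Psi> (Suc k) - \<Psi>star" and "d = \<Psi> (Suc k) - \<Psi> k" and "E' = Yh (Suc k) - Y k"
  obtain U U' Us where U: "\<Psi> k = B ** U" "\<Psi> (Suc k) = B ** U'" "\<Psi>star = B ** Us"
    using cold_dual_in_range[OF iter] Psistar_in_range by metis
  note lin = linear_diff[OF linear_matrix_mult, symmetric]
  have r: "\<psi> = B ** (U - Us)" "\<psi>' = B ** (U' - Us)" "d = B ** (U' - U)"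
    by (simp_all only: \<psi>_def \<psi>'_def d_def U lin)
  have d: "d = \<tau> *\<^sub>R (B ** Yh (Suc k))" using cold_round(3)[OF iter k] by (simp add: d_def)
  have Yh: "Yh (Suc k) = x' + Xstar + \<gamma> *\<^sub>R d + E'"
    by (simp add: x'_def d_def E'_def cold_message[OF iter, of k])
  have "d = B ** (\<tau> *\<^sub>R Yh (Suc k))" unfolding d by (simp add: linear_cmul[OF linear_matrix_mult])
  then have "\<psi>' \<bullet> (\<Theta> ** d) = (1 / \<tau>) * ((U' - Us) \<bullet> d) - \<gamma> * (\<psi>' \<bullet> d)"
    using Theta_form[of "U' - Us" "\<tau> *\<^sub>R Yh (Suc k)"] by (simp add: r(2))
  also have "(U' - Us) \<bullet> d = \<tau> * (\<psi>' \<bullet> Yh (Suc k))"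
    unfolding d r(2) frobenius_adjoint[OF B_sym] by simp
  also have "\<psi>' \<bullet> Yh (Suc k) = \<psi>' \<bullet> (x' + E') + \<gamma> * (\<psi>' \<bullet> d)"
  proof -
    have "\<psi>' \<bullet> Xstar = 0" unfolding r(2) frobenius_adjoint[OF B_sym] consensus_null by simp
    then show ?thesis unfolding Yh by (simp add: inner_add_right)
  qed
  finally have cross: "\<psi>' \<bullet> (\<Theta> ** d) = \<psi>' \<bullet> (x' + E')" using tau(1) by simp
  have "\<psi> = \<psi>' - d" by (simp add: \<psi>_def \<psi>'_def d_def)
  then have "wnorm2 \<Theta> \<psi> = wnorm2 \<Theta> \<psi>' - (\<psi>' \<bullet> (\<Theta> ** d) + d \<bullet> (\<Theta> ** \<psi>')) + wnorm2 \<Theta> d"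
    by (simp add: wnorm2_eq_inner linear_diff[OF linear_matrix_mult] inner_diff_left inner_diff_right)
  also have "d \<bullet> (\<Theta> ** \<psi>') = \<psi>' \<bullet> (\<Theta> ** d)" unfolding r by (rule Theta_form_sym)
  finally have q: "wnorm2 \<Theta> \<psi> = wnorm2 \<Theta> \<psi>' - 2 * (\<psi>' \<bullet> (x' + E')) + wnorm2 \<Theta> d"
    unfolding cross by simp
  \<comment> \<open>The gradient step, rewritten backwards from the new iterate.\<close>
  have z: "X k - Xstar - \<gamma> *\<^sub>R (rowwise gf (X k) - rowwise gf Xstar) = x' + \<gamma> *\<^sub>R \<psi>'"
    unfolding x'_def cold_round(4)[OF iter k] by (simp add: \<psi>'_def Psistar scaleR_diff_right scaleR_add_right)
  show ?thesis
    unfolding lyapunov_eq noiseless_def x'_def[symmetric] \<psi>'_def[symmetric] d_def[symmetric]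
      E'_def[symmetric] \<psi>_def[symmetric]
    by (rule energy_step[OF gamma(1) z q weights(1) _ weights(6)])
       (use exact weights(3) in \<open>auto simp: E'_def\<close>)
qed

text \<open>Both \<open>Y^k\<close> and \<open>Y^(k-1)\<close> are explicit in terms of \<open>X^k\<close> and dual variables, so the compressor input is,
  up to the old error, \<open>\<gamma>\<close> times quantities that vanish at the optimum.\<close>

lemma lyapunov_dissipation:
  assumes iter: "cold_iteration \<gamma> \<tau> W gf C X0 X Y Yh \<Psi>" and k: "1 \<le> k"
  shows "noiseless (X k) (\<Psi> k) + \<kappa> * (\<delta> * (norm (Y k - Yh k))\<^sup>2)
     \<le> \<sigma> * lyapunov (X k) (Yh k) (\<Psi> k) (Y (k - 1)) (\<Psi> (k - 1))"
proof -
  define g where "g = rowwise gf (X k) - rowwise gf Xstar"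
  define \<psi> d where "\<psi> = \<Psi> k - \<Psi>star" and "d = \<Psi> k - \<Psi> (k - 1)"
  obtain U U' Us where U: "\<Psi> (k - 1) = B ** U" "\<Psi> k = B ** U'" "\<Psi>star = B ** Us"
    using cold_dual_in_range[OF iter] Psistar_in_range by metis
  note lin = linear_diff[OF linear_matrix_mult, symmetric]
  have r: "\<psi> = B ** (U' - Us)" "d = B ** (U' - U)"
    by (simp_all only: \<psi>_def d_def U lin)
  have Y': "Y (k - 1) = X k + \<gamma> *\<^sub>R d" using cold_message[OF iter, of "k - 1"] k by (simp add: d_def)
  have Yk: "Y k = X k - \<gamma> *\<^sub>R rowwise gf (X k) - \<gamma> *\<^sub>R \<Psi> k" by (rule cold_round(1)[OF iter k])
  have y: "Y k - Yh k = - (\<gamma> *\<^sub>R (\<psi> + (g + d))) - (Yh k - Y (k - 1))"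
    unfolding Y' Yk by (simp add: \<psi>_def g_def Psistar algebra_simps)
  have q0: "0 \<le> wnorm2 \<Theta> \<psi>"
  proof -
    have "0 \<le> (1 + \<delta>) / (1 - \<delta>) * \<gamma> * (norm \<psi>)\<^sup>2" using delta gamma by simp
    then show ?thesis using Theta_bounds(1)[of "U' - Us"] unfolding r(1) by linarith
  qed
  show ?thesis
    unfolding lyapunov_eq noiseless_def g_def[symmetric] \<psi>_def[symmetric] d_def[symmetric]
  proof (rule dissipation_step[OF delta gamma(1) weights(1,4) _ y])
    show "\<gamma> * \<tau> * \<rho> * (wnorm2 \<Theta> \<psi> + \<gamma> * (norm \<psi>)\<^sup>2) \<le> \<gamma> * (norm \<psi>)\<^sup>2"
      unfolding r(1) by (rule Theta_bounds(2))
    show "(1 + \<delta>) / (1 - \<delta>) * \<gamma> * (norm d)\<^sup>2 \<le> wnorm2 \<Theta> d"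
      unfolding r(2) by (rule Theta_bounds(1))
    show "(norm (X k - Xstar - \<gamma> *\<^sub>R g))\<^sup>2 \<le> (1 - 2 * \<mu> * L * \<gamma> / (\<mu> + L)) * (norm (X k - Xstar))\<^sup>2
        - \<gamma>\<^sup>2 * ((1 + \<delta>) / (1 - \<delta>)) * (norm g)\<^sup>2"
      unfolding g_def by (rule gradient_step_contraction)
  qed (use q0 sigma_lower root_bounds theta_rho weights in auto)
qed

end

section \<open>Contraction of the expected Lyapunov value\<close>

text \<open>Round \<open>k\<close> draws the seeds of index \<open>k\<close> only after \<open>Y k\<close> is formed. So \<open>Y k\<close> depends on the seeds before
  \<open>k\<close>, while the other iterates of index \<open>k + 1\<close> may depend on round \<open>k\<close> too.\<close>

lemma cold_iterates_L2_adapted: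
  fixes Q :: "'s \<Rightarrow> real^'d \<Rightarrow> real^'d" and \<xi> :: "nat \<Rightarrow> 'n::finite \<Rightarrow> 'w \<Rightarrow> 's"
    and X Y Yh \<Psi> :: "nat \<Rightarrow> 'w \<Rightarrow> real^'d^'n"
  assumes seeds: "fresh_seeds M D \<xi>" and comp: "compressor \<delta> D Q" and \<delta>: "0 \<le> \<delta>"
    and lip: "\<And>i x y. norm (gf i x - gf i y) \<le> L * norm (x - y)" and L: "0 \<le> L"
    and iter: "\<And>\<omega>. \<omega> \<in> space M \<Longrightarrow>
          cold_iteration \<gamma> \<tau> W gf (\<lambda>k. rowwise (\<lambda>i. Q (\<xi> k i \<omega>))) X0
            (\<lambda>k. X k \<omega>) (\<lambda>k. Y k \<omega>) (\<lambda>k. Yh k \<omega>) (\<lambda>k. \<Psi> k \<omega>)"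
  shows "L2_adapted M D \<xi> (Suc k) (X (Suc k))" "L2_adapted M D \<xi> (Suc k) (Yh (Suc k))"
    "L2_adapted M D \<xi> (Suc k) (\<Psi> (Suc k))" "L2_adapted M D \<xi> k (Y k)" "L2_adapted M D \<xi> k (\<Psi> k)"
proof -
  note ad = L2_adapted_add[OF seeds] L2_adapted_diff[OF seeds] L2_adapted_scaleR[OF seeds]
  note cong = L2_adapted_cong[OF seeds, THEN iffD2]
  have grad: "L2_adapted M D \<xi> k (\<lambda>\<omega>. rowwise gf (A \<omega>))" if "L2_adapted M D \<xi> k A" for k A
    using that rowwise_lipschitz[OF lip L] L by (rule L2_adapted_lipschitz[OF seeds])
  have "L2_adapted M D \<xi> (Suc k) (X (Suc k)) \<and> L2_adapted M D \<xi> (Suc k) (Yh (Suc k))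
    \<and> L2_adapted M D \<xi> (Suc k) (\<Psi> (Suc k)) \<and> L2_adapted M D \<xi> k (Y k) \<and> L2_adapted M D \<xi> k (\<Psi> k)"
  proof (induction k)
    case 0
    define y0 where "y0 = X0 - \<gamma> *\<^sub>R rowwise gf X0"
    have init: "Y 0 \<omega> = y0" "X (Suc 0) \<omega> = y0" "Yh (Suc 0) \<omega> = rowwise (\<lambda>i. Q (\<xi> 0 i \<omega>)) y0"
      "\<Psi> 0 \<omega> = 0" "\<Psi> (Suc 0) \<omega> = 0" if "\<omega> \<in> space M" for \<omega>
      using iter[OF that] by (simp_all add: cold_iteration_def y0_def)
    show ?case
      by (intro conjI; rule cong, erule init)
         (rule L2_adapted_const[OF seeds] L2_adapted_compression[OF seeds comp \<delta> L2_adapted_const[OF seeds]])+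
  next
    case (Suc k)
    let ?k = "Suc k"
    have X: "L2_adapted M D \<xi> ?k (X ?k)" and Yh: "L2_adapted M D \<xi> ?k (Yh ?k)" and \<Psi>: "L2_adapted M D \<xi> ?k (\<Psi> ?k)"
      using Suc by auto
    note round = cold_round[OF iter, of _ ?k, simplified]
    have Y: "L2_adapted M D \<xi> ?k (Y ?k)"
      by (rule cong, erule round(1)) (intro ad grad X \<Psi>)
    have Yh': "L2_adapted M D \<xi> (Suc ?k) (Yh (Suc ?k))"
      by (rule cong, erule round(2))
         (intro ad L2_adapted_compression[OF seeds comp \<delta>] L2_adapted_mono[OF seeds Yh] Y Yh le_SucI order_refl)
    have \<Psi>': "L2_adapted M D \<xi> (Suc ?k) (\<Psi> (Suc ?k))"
      by (rule cong, erule round(3))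
         (intro ad L2_adapted_linear[OF seeds Yh'] linear_matrix_mult L2_adapted_mono[OF seeds \<Psi>] le_SucI order_refl)
    have X': "L2_adapted M D \<xi> (Suc ?k) (X (Suc ?k))"
      by (rule cong, erule round(4))
         (intro ad grad \<Psi>' L2_adapted_mono[OF seeds X] le_SucI order_refl)
    show ?case using X' Yh' \<Psi>' Y \<Psi> by simp
  qed
  then show "L2_adapted M D \<xi> (Suc k) (X (Suc k))" "L2_adapted M D \<xi> (Suc k) (Yh (Suc k))"
    "L2_adapted M D \<xi> (Suc k) (\<Psi> (Suc k))" "L2_adapted M D \<xi> k (Y k)" "L2_adapted M D \<xi> k (\<Psi> k)" by auto
qed

theorem theorem3:
  fixes E :: "'n::finite rel" and W :: "real^'n^'n"
    and f :: "'n \<Rightarrow> real^'d \<Rightarrow> real" and gf :: "'n \<Rightarrow> real^'d \<Rightarrow> real^'d"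
    and D :: "'s measure" and Q :: "'s \<Rightarrow> real^'d \<Rightarrow> real^'d"
    and M :: "'w measure" and \<xi> :: "nat \<Rightarrow> 'n \<Rightarrow> 'w \<Rightarrow> 's"
    and X0 :: "real^'d^'n" and X Y Yh \<Psi> :: "nat \<Rightarrow> 'w \<Rightarrow> real^'d^'n"
    and xstar :: "real^'d" and Xstar \<Psi>star :: "real^'d^'n" and \<Theta> :: "real^'n^'n"
    and \<mu> L \<delta> \<delta>' \<gamma> \<tau> \<rho> \<sigma> :: real and V :: "nat \<Rightarrow> 'w \<Rightarrow> real" and e :: "nat \<Rightarrow> real"
  assumes n: "2 \<le> CARD('n)"
    and network: "network_assumption E W"
    and mu_L: "0 < \<mu>" "\<mu> \<le> L"
    and cost: "cost_assumption \<mu> L f gf"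
    and xstar: "is_arg_min (\<lambda>x. \<Sum>i\<in>UNIV. f i x) (\<lambda>x. True) xstar"
    and delta: "0 \<le> \<delta>" "\<delta> < 1"
    and compressor: "compressor \<delta> D Q"
    and delta': "\<delta>' = 4 * sqrt \<delta> / (1 - \<delta>)" "\<delta>' < 1"
    and seeds: "fresh_seeds M D \<xi>"
    and iteration: "\<And>\<omega>. \<omega> \<in> space M \<Longrightarrow>
          cold_iteration \<gamma> \<tau> W gf (\<lambda>k. rowwise (\<lambda>i. Q (\<xi> k i \<omega>))) X0
            (\<lambda>k. X k \<omega>) (\<lambda>k. Y k \<omega>) (\<lambda>k. Yh k \<omega>) (\<lambda>k. \<Psi> k \<omega>)"
    and gamma: "\<gamma> \<in> {0 <..< (1 - \<delta>) / (\<mu> + L)}"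
    and tau: "\<tau> \<in> {0 <..< (1 - \<delta>) / (2 * \<gamma> * (1 - nth_largest_eigenvalue CARD('n) W))}"
    and Xstar: "Xstar = (\<chi> i. xstar)"
    and Psistar: "\<Psi>star = - rowwise gf Xstar"
    and Theta: "\<Theta> = (1 / \<tau>) *\<^sub>R pseudoinverse (mat 1 - W) - mat \<gamma>"
    and rho: "\<rho> = 1 - nth_largest_eigenvalue 2 W"
    and sigma: "\<sigma> = max (1 - 2 * \<mu> * L * \<gamma> / (\<mu> + L)) (1 - \<gamma> * \<tau> * \<rho> * (1 - sqrt \<delta>'))"
    and V: "\<And>k \<omega>. V k \<omega> =
          wnorm2 (mat (1 / \<gamma>)) (X k \<omega> - Xstar)
        + wnorm2 (\<Theta> + mat ((1 - sqrt \<delta>' / 2) * \<gamma>)) (\<Psi> k \<omega> - \<Psi>star)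
        + wnorm2 \<Theta> (\<Psi> k \<omega> - \<Psi> (k - 1) \<omega>)
        + (1 + \<delta> - 4 * sqrt \<delta>) / (2 * \<gamma> * sqrt (\<delta> * \<delta>')) * (norm (Yh k \<omega> - Y (k - 1) \<omega>))\<^sup>2"
    and e: "\<And>k. e k = prob_space.expectation M (V k)"
  shows "\<sigma> < 1 \<and> (\<forall>k\<ge>1. integrable M (V k) \<and> e (k + 1) \<le> \<sigma> * e k)"
proof -
  interpret prob_space M using seeds by (simp add: fresh_seeds_def)
  interpret cold W f gf xstar Xstar \<Psi>star \<Theta> \<mu> L \<delta> \<delta>' \<gamma> \<tau> \<rho> \<sigma>
    by unfold_locales
       (use n network mu_L cost xstar delta delta' gamma tau Xstar Psistar Theta rho sigma in
         \<open>auto simp: network_assumption_def\<close>)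
  have lip: "norm (gf i x - gf i y) \<le> L * norm (x - y)" for i x y
    using cost by (simp add: cost_assumption_def)
  have L: "0 \<le> L" using mu_L by simp
  note iterates = cold_iterates_L2_adapted[OF seeds compressor delta(1) lip L iteration]
  have sq: "square_integrable M Z" if "L2_adapted M D \<xi> k Z" for k and Z :: "'w \<Rightarrow> real^'d^'n"
    using that by (simp add: L2_adapted_def)
  have V_eq: "V k \<omega> = lyapunov (X k \<omega>) (Yh k \<omega>) (\<Psi> k \<omega>) (Y (k - 1) \<omega>) (\<Psi> (k - 1) \<omega>)" for k \<omega>
    by (simp add: V lyapunov_def c_def)
  have V_int: "integrable M (V (Suc k))" for k
    unfolding V_eq[abs_def] lyapunov_def diff_Suc_1
    using iterates[THEN sq, of k] square_integrable_diff[OF iterates(2,4)[THEN sq], of k k]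
    by (intro Bochner_Integration.integrable_add integrable_mult_right integrable_wnorm2[OF finite_measure_axioms]
        square_integrable_diff square_integrable_const[OF finite_measure_axioms])
       (auto simp: square_integrable_def)
  have "e (Suc (Suc k)) \<le> \<sigma> * e (Suc k)" for k
  proof -
    let ?k = "Suc k"
    define Z where "Z \<omega> = Y ?k \<omega> - Yh ?k \<omega>" for \<omega>
    define R where "R \<omega> = noiseless (X ?k \<omega>) (\<Psi> ?k \<omega>)" for \<omega>
    define err where "err \<omega> = (norm (Yh (Suc ?k) \<omega> - Y ?k \<omega>))\<^sup>2" for \<omega>
    have Z: "L2_adapted M D \<xi> ?k Z"
      unfolding Z_def[abs_def] by (intro L2_adapted_diff[OF seeds] iterates)
    have err_eq: "err \<omega> = (norm (rowwise (\<lambda>i. Q (\<xi> ?k i \<omega>)) (Z \<omega>) - Z \<omega>))\<^sup>2" if "\<omega> \<in> space M" for \<omega>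
      using cold_round(2)[OF iteration[OF that], of ?k] by (simp add: err_def Z_def algebra_simps)
    have err_int: "integrable M err"
      using sq[OF iterates(2), of ?k] sq[OF iterates(4), of ?k] square_integrable_diff
      by (auto simp: err_def[abs_def] square_integrable_def)
    have Z_int: "integrable M (\<lambda>\<omega>. (norm (Z \<omega>))\<^sup>2)" using sq[OF Z] by (simp add: square_integrable_def)
    have "(\<integral>\<omega>. err \<omega> \<partial>M) = (\<integral>\<omega>. (norm (rowwise (\<lambda>i. Q (\<xi> ?k i \<omega>)) (Z \<omega>) - Z \<omega>))\<^sup>2 \<partial>M)"
      by (rule Bochner_Integration.integral_cong) (simp_all add: err_eq)
    also have "\<dots> \<le> \<delta> * (\<integral>\<omega>. (norm (Z \<omega>))\<^sup>2 \<partial>M)"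
      using Z by (intro fresh_compression(4)[OF seeds compressor delta(1)]) (auto simp: L2_adapted_def)
    finally have err_le: "(\<integral>\<omega>. err \<omega> \<partial>M) \<le> \<delta> * (\<integral>\<omega>. (norm (Z \<omega>))\<^sup>2 \<partial>M)" .
    \<comment> \<open>For \<open>\<delta> = 0\<close> the error is zero only almost surely, so the bound on the next value is too.\<close>
    have exact: "AE \<omega> in M. \<delta> = 0 \<longrightarrow> err \<omega> = 0"
    proof (cases "\<delta> = 0")
      case True
      have "0 \<le> (\<integral>\<omega>. err \<omega> \<partial>M)" by (simp add: err_def)
      then have "(\<integral>\<omega>. err \<omega> \<partial>M) = 0" using err_le True by simp
      moreover have "(\<integral>\<omega>. err \<omega> \<partial>M) = 0 \<longleftrightarrow> (AE \<omega> in M. err \<omega> = 0)"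
        by (rule integral_nonneg_eq_0_iff_AE[OF err_int]) (simp add: err_def)
      ultimately show ?thesis by simp
    qed simp
    have R_int: "integrable M R"
    proof -
      have "L2_adapted M D \<xi> ?k (\<lambda>\<omega>. X ?k \<omega> - Xstar - \<gamma> *\<^sub>R (rowwise gf (X ?k \<omega>) - rowwise gf Xstar))"
        by (intro L2_adapted_diff[OF seeds] L2_adapted_scaleR[OF seeds] L2_adapted_const[OF seeds]
            L2_adapted_lipschitz[OF seeds _ rowwise_lipschitz[OF lip L] L] iterates)
      from sq[OF this] sq[OF iterates(3), of k] show ?thesis
        unfolding R_def[abs_def] noiseless_def
        by (intro Bochner_Integration.integrable_add integrable_divide integrable_wnorm2[OF finite_measure_axioms]
            square_integrable_diff square_integrable_const[OF finite_measure_axioms])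
           (auto simp: square_integrable_def)
    qed
    have "e (Suc ?k) = (\<integral>\<omega>. V (Suc ?k) \<omega> \<partial>M)" by (simp add: e)
    also have "\<dots> \<le> (\<integral>\<omega>. R \<omega> + \<kappa> * err \<omega> \<partial>M)"
    proof (rule integral_mono_AE)
      show "AE \<omega> in M. V (Suc ?k) \<omega> \<le> R \<omega> + \<kappa> * err \<omega>"
        using exact AE_space
      proof eventually_elim
        case (elim \<omega>)
        then have "\<delta> = 0 \<Longrightarrow> Yh (Suc ?k) \<omega> = Y ?k \<omega>" by (simp add: err_def)
        from lyapunov_step[OF iteration[OF elim(2)] _ this]
        show ?case by (simp add: V_eq R_def err_def)
      qed
    qed (use V_int R_int err_int in auto)
    also have "\<dots> = (\<integral>\<omega>. R \<omega> \<partial>M) + \<kappa> * (\<integral>\<omega>. err \<omega> \<partial>M)"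
      using R_int err_int by simp
    also have "\<dots> \<le> (\<integral>\<omega>. R \<omega> \<partial>M) + \<kappa> * (\<delta> * (\<integral>\<omega>. (norm (Z \<omega>))\<^sup>2 \<partial>M))"
      using err_le weights(5) by (intro add_left_mono mult_left_mono)
    also have "\<dots> = (\<integral>\<omega>. R \<omega> + \<kappa> * (\<delta> * (norm (Z \<omega>))\<^sup>2) \<partial>M)"
      using R_int Z_int by simp
    also have "\<dots> \<le> (\<integral>\<omega>. \<sigma> * V ?k \<omega> \<partial>M)"
    proof (rule integral_mono)
      fix \<omega> assume "\<omega> \<in> space M"
      from lyapunov_dissipation[OF iteration[OF this], of ?k]
      show "R \<omega> + \<kappa> * (\<delta> * (norm (Z \<omega>))\<^sup>2) \<le> \<sigma> * V ?k \<omega>"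
        by (simp add: V_eq R_def Z_def)
    qed (use V_int R_int Z_int in auto)
    also have "\<dots> = \<sigma> * e ?k" by (simp add: e)
    finally show ?thesis .
  qed
  then have "integrable M (V k) \<and> e (k + 1) \<le> \<sigma> * e k" if "1 \<le> k" for k
    using that V_int by (cases k) auto
  then show ?thesis using sigma_less_1 by blast
qed

end
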